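(* Let $H$ be a countable (finite or infinite) subgroup of an infinite Abelian group $G$. If $G$ contains a nonzero element of infinite height, then $H\in\mathcal{NRC}(G)$.
   Context: An element $g\in G$ has infinite height if $g\in\bigcap_{n\geq 1} nG$, i.e. $g$ is divisible in $G$ by every positive integer. For a topological Abelian group $X$, $X^\wedge$ is the group of continuous characters (continuous homomorphisms to the circle group), and $\mathbf{n}(X)=\bigcap_{\chi\in X^\wedge}\ker\chi$ is the von Neumann radical of $X$. For an infinite Abelian group $G$, $\mathcal{NRC}(G)$ is the set of all subgroups $H$ of $G$ for which there exists a complete non-discrete Hausdorff group topology $\tau$ on $G$ with $\mathbf{n}(G,\tau)=H$. *)

theory Defs
  imports "HOL-Analysis.Analysis" "HOL-Algebra.Coset"
begin

text \<open>
  Abelian groups are \<^const>\<open>comm_group\<close> structures, written multiplicatively: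
  the multiple \<open>n g\<close> of the additive notation is \<open>g [^] n\<close>.
  Group topologies are abstract topologies whose space is the carrier.
\<close>

definition infinite_height :: "('a, 'b) monoid_scheme \<Rightarrow> 'a \<Rightarrow> bool" where
  "infinite_height G g \<longleftrightarrow> g \<in> (\<Inter>n\<in>{1::nat..}. (\<lambda>x. x [^]\<^bsub>G\<^esub> n) ` carrier G)"

definition group_topology :: "('a, 'b) monoid_scheme \<Rightarrow> 'a topology \<Rightarrow> bool" where
  "group_topology G T \<longleftrightarrow>
     topspace T = carrier G \<and>
     continuous_map (prod_topology T T) T (\<lambda>(x, y). x \<otimes>\<^bsub>G\<^esub> y) \<and>
     continuous_map T T (\<lambda>x. inv\<^bsub>G\<^esub> x)"

text \<open>
  Completeness is that of the group uniformity, whose entourages are generated by the sets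
  \<open>{(x, y). x y\<inverse> \<in> U}\<close> for the neighbourhoods \<open>U\<close> of the identity;
  for Abelian groups the left, right and two-sided uniformities coincide.
\<close>

definition group_cauchy_filter ::
    "('a, 'b) monoid_scheme \<Rightarrow> 'a topology \<Rightarrow> 'a filter \<Rightarrow> bool" where
  "group_cauchy_filter G T F \<longleftrightarrow>
     F \<noteq> bot \<and> F \<le> principal (carrier G) \<and>
     (\<forall>U. openin T U \<and> \<one>\<^bsub>G\<^esub> \<in> U \<longrightarrow>
        (\<forall>\<^sub>F (x, y) in F \<times>\<^sub>F F. x \<otimes>\<^bsub>G\<^esub> inv\<^bsub>G\<^esub> y \<in> U))"

definition complete_group_topology :: "('a, 'b) monoid_scheme \<Rightarrow> 'a topology \<Rightarrow> bool" where
  "complete_group_topology G T \<longleftrightarrow>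
     (\<forall>F. group_cauchy_filter G T F \<longrightarrow> (\<exists>l. limitin T (\<lambda>x. x) l F))"

definition circle_group :: "complex monoid" where
  "circle_group = \<lparr>carrier = sphere 0 1, mult = (*), one = 1\<rparr>"

text \<open>
  Two functions that agree on the carrier represent the same character; the values outside the
  carrier are immaterial for the radical, as \<^const>\<open>kernel\<close> is taken within the carrier.
\<close>

definition characters :: "('a, 'b) monoid_scheme \<Rightarrow> 'a topology \<Rightarrow> ('a \<Rightarrow> complex) set" where
  "characters G T =
     {\<phi>. \<phi> \<in> hom G circle_group \<and> continuous_map T (top_of_set (sphere 0 1)) \<phi>}"

definition von_Neumann_radical :: "('a, 'b) monoid_scheme \<Rightarrow> 'a topology \<Rightarrow> 'a set" where
  "von_Neumann_radical G T = (\<Inter>\<phi>\<in>characters G T. kernel G circle_group \<phi>)"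

definition NRC :: "('a, 'b) monoid_scheme \<Rightarrow> 'a set set" where
  "NRC G = {H. subgroup H G \<and>
     (\<exists>T. group_topology G T \<and> Hausdorff_space T \<and> complete_group_topology G T \<and>
          T \<noteq> discrete_topology (carrier G) \<and> von_Neumann_radical G T = H)}"

end

theory Submission
  imports Defs "HOL-Algebra.Generated_Groups" "HOL-Algebra.FiniteProduct"
    "HOL-Library.Discrete_Functions"
begin

text \<open>
  The topology is the finest group topology in which a suitable sequence of elements converges to
  the identity. Such a topology is always complete (\<open>complete_null_topology\<close>), and a homomorphism
  to the circle is continuous iff it tends to 1 along the sequence, so it remains to choose the
  sequence such that the topology is Hausdorff and exactly the right characters are continuous.

  Enumerate \<open>H\<close> as \<open>h 0, h 1, \<dots>\<close>, with every element occurring infinitely often, and choose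
  elements \<open>y 0, y 1, \<dots>\<close> such that the order of \<open>y k\<close> is very large modulo the finitely generated
  subgroup \<open>F k\<close> spanned by \<open>y i\<close> for \<open>i < k\<close> and \<open>h i\<close> for \<open>i \<le> k\<close>. The sequence consists
  of the powers of \<open>y k\<close> with exponents of modulus at most \<open>(k + 1)\<^sup>2\<close> and of the products
  \<open>d m = h m \<cdot> \<Prod> y l\<close>, where \<open>l\<close> ranges over the \<open>m\<close>-th dyadic block, of length \<open>2\<^sup>m\<close>.

  \<^item> Every continuous character is trivial on \<open>H\<close>. If many consecutive powers of \<open>\<phi> (y k)\<close> are near
    1, then \<open>\<phi> (y k)\<close> itself is extremely near 1, so the product of the \<open>\<phi> (y l)\<close> over a block
    tends to 1. As \<open>\<phi> (d m)\<close> tends to 1, so does \<open>\<phi> (h m)\<close>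
    (\<open>character_trivial_on_frequent_value\<close>).
  \<^item> The topology is Hausdorff. A product of few terms of the sequence cannot cancel all \<open>2\<^sup>m\<close>
    factors of a \<open>d m\<close>; hence, unless the product is formally trivial, there is a largest \<open>k\<close> such
    that \<open>y k\<close> survives, with a small exponent, and the product cannot lie in \<open>F k\<close>
    (\<open>trivial_of_represented\<close>).
  \<^item> Every \<open>a \<notin> H\<close> is moved by a continuous character that is trivial on \<open>H\<close>. The elements are
    chosen such that either \<open>y k\<close> lies in \<open>H\<close> or its order modulo \<open>H\<close> together with
    \<open>F k\<close> is large; in the latter case a character defined on this subgroup extends to \<open>y k\<close> with
    a value close to 1 (\<open>exists_close_separating_character\<close>).

  The element of infinite height enters only in the choice of \<open>y k\<close>
  (\<open>exists_large_order_mod\<close>). If no such element existed for a finitely generated \<open>F\<close>,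
  then the elements of \<open>H\<close> would have bounded order modulo \<open>F\<close>, and those of \<open>G\<close> modulo
  \<open>H\<close> and \<open>F\<close>, so some power map with positive exponent would send \<open>G\<close> into \<open>F\<close>; but a finitely generated
  abelian group has no nontrivial elements of infinite height (\<open>finitely_generated_residual\<close>).
\<close>

section \<open>Finitely generated subgroups and elements of infinite height\<close>

lemma (in group) int_pow_mem_abs:
  assumes K: "subgroup K G" and x: "x \<in> carrier G" and "x [^] (i::int) \<in> K"
  shows "x [^] (nat \<bar>i\<bar>) \<in> K"
proof -
  have "x [^] (- i) \<in> K"
    using assms subgroup.m_inv_closed[OF K] by (simp add: int_pow_neg)
  then have "x [^] \<bar>i\<bar> \<in> K"
    using assms by (simp add: abs_if)
  then show ?thesis
    by (metis abs_ge_zero int_nat_eq int_pow_int)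
qed

lemma (in comm_group) generate_Un_subset:
  assumes "A \<subseteq> carrier G" "B \<subseteq> carrier G"
  shows "generate G (A \<union> B) \<subseteq> generate G A <#> generate G B"
proof (rule generate_subgroup_incl)
  show "subgroup (generate G A <#> generate G B) G"
    using assms by (simp add: mult_subgroups generate_is_subgroup)
  have "a \<in> generate G A <#> generate G B" if "a \<in> A" for a
    using that assms generate.incl[of a A G] generate.one[of G B]
    by (force simp: set_mult_def)
  moreover have "b \<in> generate G A <#> generate G B" if "b \<in> B" for b
    using that assms generate.incl[of b B G] generate.one[of G A]
    by (force simp: set_mult_def)
  ultimately show "A \<union> B \<subseteq> generate G A <#> generate G B"
    by blast
qed

lemma (in comm_group) generate_insertE:
  assumes "x \<in> generate G (insert y S)" "y \<in> carrier G" "S \<subseteq> carrier G"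
  obtains a i where "a \<in> generate G S" "x = a \<otimes> y [^] (i::int)"
proof -
  have "x \<in> generate G S <#> generate G {y}"
    using generate_Un_subset[of S "{y}"] assms by auto
  then show ?thesis
    using that assms by (auto simp: set_mult_def generate_pow)
qed

lemma (in comm_group) generate_subgroup_UnE:
  assumes "x \<in> generate G (H \<union> S)" "subgroup H G" "S \<subseteq> carrier G"
  obtains h a where "h \<in> H" "a \<in> generate G S" "x = h \<otimes> a"
proof -
  have "x \<in> generate G H <#> generate G S"
    using generate_Un_subset[of H S] assms subgroup.subset by blast
  moreover have "generate G H \<subseteq> H"
    using assms by (simp add: generate_subgroup_incl)
  ultimately show ?thesis
    using that by (auto simp: set_mult_def)
qed

text \<open>
  For \<open>K = {\<one>}\<close> this says that a finitely generated abelian group has no nontrivial elements of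
  infinite height. The relative version with a subgroup \<open>K\<close> permits induction on the number of
  generators without passing to quotients: enlarging \<open>K\<close> by \<open>y\<^sup>q\<close> makes the generator \<open>y\<close> torsion
  modulo \<open>K\<close>, and then powers with exponents divisible by \<open>q\<close> no longer see \<open>y\<close>.
\<close>

lemma (in comm_group) finitely_generated_residual:
  assumes "finite S" "S \<subseteq> carrier G" "subgroup K G" "g \<in> carrier G"
    and "\<And>n::nat. n \<ge> 1 \<Longrightarrow> \<exists>a\<in>generate G S. g \<otimes> a [^] n \<in> K"
  shows "g \<in> K"
  using assms
proof (induction S arbitrary: K rule: finite_induct)
  case empty
  then show ?case
    using empty(4)[of 1] by (auto simp: generate_empty)
next
  case (insert y S K)
  have y: "y \<in> carrier G" and S: "S \<subseteq> carrier G"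
    using insert.prems by auto
  have K: "k \<in> carrier G" if "k \<in> K" for k
    using that insert.prems(2) subgroup.mem_carrier by metis
  have gS: "a \<in> carrier G" if "a \<in> generate G S" for a
    using that S generate_in_carrier by blast
  have mem: "\<exists>k\<in>K. \<exists>i::int. g = k \<otimes> y [^] (int q * i)" if q: "q \<ge> 1" for q :: nat
  proof -
    have "g \<in> K <#> generate G {y [^] q}"
    proof (rule insert.IH[OF S])
      show "subgroup (K <#> generate G {y [^] q}) G"
        using insert.prems y by (simp add: mult_subgroups generate_is_subgroup)
      show "g \<in> carrier G" by fact
      fix n :: nat assume "n \<ge> 1"
      then obtain a' where a': "a' \<in> generate G (insert y S)" "g \<otimes> a' [^] (q * n) \<in> K"
        using insert.prems(4)[of "q * n"] q by auto
      obtain a i where a: "a \<in> generate G S" "a' = a \<otimes> y [^] (i::int)"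
        using generate_insertE[OF a'(1) y S] .
      have yp: "(y [^] i) [^] (q * n) = (y [^] q) [^] (i * int n)"
      proof -
        have "(y [^] i) [^] (q * n) = y [^] (i * int (q * n))"
          using y by (metis int_pow_int int_pow_pow)
        also have "\<dots> = y [^] (int q * (i * int n))"
          by (simp add: algebra_simps)
        also have "\<dots> = (y [^] q) [^] (i * int n)"
          using y by (metis int_pow_int int_pow_pow)
        finally show ?thesis .
      qed
      have eq: "a' [^] (q * n) = (a [^] q) [^] n \<otimes> (y [^] q) [^] (i * int n)"
        using a gS y yp by (simp add: nat_pow_distrib nat_pow_pow)
      let ?w = "(y [^] q) [^] (i * int n)"
      have w: "?w \<in> carrier G" "?w \<in> generate G {y [^] q}" "inv ?w \<in> generate G {y [^] q}"
        using y by (auto simp: generate_pow int_pow_neg[symmetric])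
      have ac: "a [^] q \<in> generate G S"
        using a(1) S by (metis generate_is_subgroup int_pow_int subgroup_int_pow_closed)
      have "g \<otimes> (a [^] q) [^] n = (g \<otimes> a' [^] (q * n)) \<otimes> inv ?w"
        using w(1) ac gS insert.prems(3) by (simp add: eq m_assoc)
      then have "g \<otimes> (a [^] q) [^] n \<in> K <#> generate G {y [^] q}"
        using a'(2) w(3) by (auto simp: set_mult_def)
      then show "\<exists>a\<in>generate G S. g \<otimes> a [^] n \<in> K <#> generate G {y [^] q}"
        using ac by blast
    qed
    then obtain k i where "k \<in> K" "g = k \<otimes> (y [^] q) [^] (i::int)"
      using y by (auto simp: set_mult_def generate_pow)
    moreover have "(y [^] q) [^] i = y [^] (int q * i)"
      using y by (metis int_pow_int int_pow_pow)
    ultimately show ?thesis by auto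
  qed
  obtain k c where k: "k \<in> K" "g = k \<otimes> y [^] (c::int)"
    using mem[of 1] by auto
  show ?case
  proof (cases "c = 0")
    case True
    then show ?thesis using k K by simp
  next
    case False
    \<comment> \<open>With this \<open>q\<close> the two exponents \<open>c\<close> and \<open>q i\<close> of \<open>y\<close> differ, so \<open>y\<close> has finite order modulo \<open>K\<close>.\<close>
    define q where "q = nat (2 * \<bar>c\<bar>)"
    have "q \<ge> 1" using False by (simp add: q_def)
    then obtain k' i where k': "k' \<in> K" "g = k' \<otimes> y [^] (int q * i)"
      using mem[of q] by blast
    define r where "r = c - int q * i"
    have "r \<noteq> 0"
    proof
      assume "r = 0"
      then have "c = 2 * \<bar>c\<bar> * i" by (simp add: r_def q_def)
      then have "\<bar>c\<bar> = \<bar>c\<bar> * (2 * \<bar>i\<bar>)" by (metis abs_abs abs_mult abs_numeral mult.assoc mult.commute)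
      then have "2 * \<bar>i\<bar> = 1" using False by simp
      then show False by presburger
    qed
    have "y [^] c = inv k \<otimes> g"
      using k K y by (simp add: m_assoc[symmetric])
    also have "\<dots> = inv k \<otimes> k' \<otimes> y [^] (int q * i)"
      using k(1) k' K y by (simp add: m_assoc)
    finally have "y [^] r = inv k \<otimes> k'"
      using k(1) k'(1) K y by (simp add: r_def int_pow_diff m_assoc)
    then have "y [^] r \<in> K"
      using k(1) k'(1) insert.prems(2) by (simp add: subgroup.m_closed subgroup.m_inv_closed)
    then have r: "y [^] (nat \<bar>r\<bar>) \<in> K"
      using int_pow_mem_abs insert.prems(2) y by blast
    have "nat \<bar>r\<bar> \<ge> 1" using \<open>r \<noteq> 0\<close> by simp
    then obtain k'' i' where k'': "k'' \<in> K" "g = k'' \<otimes> y [^] (int (nat \<bar>r\<bar>) * i')"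
      using mem[of "nat \<bar>r\<bar>"] by blast
    have "y [^] (int (nat \<bar>r\<bar>) * i') = (y [^] nat \<bar>r\<bar>) [^] i'"
      using y by (metis int_pow_int int_pow_pow)
    then have "y [^] (int (nat \<bar>r\<bar>) * i') \<in> K"
      using r subgroup_int_pow_closed[OF insert.prems(2)] by simp
    then show ?thesis
      using k'' subgroup.m_closed[OF insert.prems(2)] by simp
  qed
qed

text \<open>
  Otherwise raising to the power \<open>R!\<close> maps \<open>H\<close> into \<open>F = generate G S\<close> and \<open>G\<close> into the product of
  \<open>H\<close> and \<open>F\<close>, so raising to the power \<open>(R!)\<^sup>2\<close> maps \<open>G\<close> into \<open>F\<close>, and \<open>g\<close> has infinite height in the finitely generated group \<open>F\<close>.
  The alternative \<open>y \<in> H\<close> cannot be avoided, since \<open>G\<close> may be bounded modulo \<open>H\<close>.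
\<close>

lemma (in comm_group) exists_large_order_mod:
  assumes g: "g \<in> carrier G" "g \<noteq> \<one>" "infinite_height G g"
    and H: "subgroup H G" and S: "finite S" "S \<subseteq> carrier G"
  shows "\<exists>y\<in>carrier G. (\<forall>n\<in>{1..R::nat}. y [^] n \<notin> generate G S) \<and>
            (y \<in> H \<or> (\<forall>n\<in>{1..R}. y [^] n \<notin> generate G (H \<union> S)))"
proof (rule ccontr)
  assume "\<not> ?thesis"
  then have nex: "(\<exists>n\<in>{1..R}. y [^] n \<in> generate G S) \<or>
      (y \<notin> H \<and> (\<exists>n\<in>{1..R}. y [^] n \<in> generate G (H \<union> S)))" if "y \<in> carrier G" for y
    using that by blast
  let ?F = "generate G S"
  have F: "subgroup ?F G" "subgroup (generate G (H \<union> S)) G"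
    using S H by (auto intro!: generate_is_subgroup dest: subgroup.mem_carrier)
  have pow: "y [^] (fact R::nat) \<in> L" if "subgroup L G" "y \<in> carrier G" "n \<in> {1..R}" "y [^] n \<in> L" for y n L
  proof -
    have "n dvd fact R" using that by (auto intro: dvd_fact)
    then obtain m where "fact R = n * m" by auto
    then have "y [^] (fact R::nat) = (y [^] n) [^] int m"
      using that by (simp add: nat_pow_pow int_pow_int)
    then show ?thesis using that subgroup_int_pow_closed by metis
  qed
  have powH: "h [^] (fact R::nat) \<in> ?F" if "h \<in> H" for h
    using nex[of h] that H subgroup.mem_carrier pow[OF F(1)] by metis
  have powF: "a [^] (n::nat) \<in> ?F" if "a \<in> ?F" for a n
    using that F(1) subgroup_int_pow_closed int_pow_int by metis
  define q :: nat where "q = fact R * fact R"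
  have powG: "y [^] q \<in> ?F" if y: "y \<in> carrier G" for y
  proof -
    have "?F \<subseteq> generate G (H \<union> S)" by (simp add: mono_generate)
    then have "y [^] (fact R::nat) \<in> generate G (H \<union> S)"
      using nex[OF y] pow[OF F(2) y] by blast
    then obtain h a where ha: "h \<in> H" "a \<in> ?F" "y [^] (fact R::nat) = h \<otimes> a"
      using generate_subgroup_UnE H S by metis
    then have c: "h \<in> carrier G" "a \<in> carrier G"
      using H F subgroup.mem_carrier by metis+
    have "y [^] q = h [^] (fact R::nat) \<otimes> a [^] (fact R::nat)"
      using y c ha(3) by (simp add: q_def nat_pow_distrib flip: nat_pow_pow)
    then show ?thesis
      using powH[OF ha(1)] powF[OF ha(2)] F(1) by (simp add: subgroup.m_closed)
  qed
  have "q \<ge> 1" by (simp add: q_def Suc_le_eq)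
  have "g \<in> {\<one>}"
  proof (rule finitely_generated_residual[OF S _ g(1)])
    show "subgroup {\<one>} G" by (simp add: triv_subgroup)
    fix n :: nat assume "n \<ge> 1"
    then have "q * n \<ge> 1" using \<open>q \<ge> 1\<close> by simp
    then obtain x where x: "x \<in> carrier G" "g = x [^] (q * n)"
      using g(3) unfolding infinite_height_def by blast
    have "g \<otimes> (inv (x [^] q)) [^] n = \<one>"
      using x by (simp add: nat_pow_inv nat_pow_pow)
    moreover have "inv (x [^] q) \<in> ?F"
      using powG[OF x(1)] F(1) by (simp add: subgroup.m_inv_closed)
    ultimately show "\<exists>a\<in>?F. g \<otimes> a [^] n \<in> {\<one>}" by blast
  qed
  then show False using g by simp
qed

section \<open>Extending characters\<close>

lemma norm_cis_minus_1_le: "norm (cis t - 1) \<le> \<bar>t\<bar>"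
proof -
  have "norm (cis t - 1) = 2 * \<bar>sin (t / 2)\<bar>"
    using dist_exp_i_1[of t] by (simp add: cis_conv_exp)
  then show ?thesis using abs_sin_x_le_abs_x[of "t / 2"] by simp
qed

text \<open>
  A homomorphism from a subgroup of \<open>G\<close> to the circle, given by its graph. In this form extensions
  are inclusions and the union of a chain of partial characters is one again.
\<close>

definition partial_character :: "('a, 'b) monoid_scheme \<Rightarrow> ('a \<times> complex) set \<Rightarrow> bool" where
  "partial_character G R \<longleftrightarrow>
     (\<forall>x z. (x, z) \<in> R \<longrightarrow> x \<in> carrier G \<and> norm z = 1) \<and>
     (\<one>\<^bsub>G\<^esub>, 1) \<in> R \<and>
     (\<forall>x z x' z'. (x, z) \<in> R \<longrightarrow> (x', z') \<in> R \<longrightarrow> (x \<otimes>\<^bsub>G\<^esub> x', z * z') \<in> R) \<and>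
     (\<forall>x z. (x, z) \<in> R \<longrightarrow> (inv\<^bsub>G\<^esub> x, inverse z) \<in> R) \<and>
     (\<forall>z. (\<one>\<^bsub>G\<^esub>, z) \<in> R \<longrightarrow> z = 1)"

context comm_group
begin

lemma partial_characterD:
  assumes "partial_character G R"
  shows "(x, z) \<in> R \<Longrightarrow> x \<in> carrier G" "(x, z) \<in> R \<Longrightarrow> norm z = 1" "(x, z) \<in> R \<Longrightarrow> z \<noteq> 0"
    "(\<one>, 1) \<in> R" "(x, z) \<in> R \<Longrightarrow> (x', z') \<in> R \<Longrightarrow> (x \<otimes> x', z * z') \<in> R"
    "(x, z) \<in> R \<Longrightarrow> (inv x, inverse z) \<in> R" "(\<one>, z) \<in> R \<Longrightarrow> z = 1"
proof -
  show 1: "(x, z) \<in> R \<Longrightarrow> x \<in> carrier G" "(x, z) \<in> R \<Longrightarrow> norm z = 1"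
    using assms by (simp_all add: partial_character_def)
  show "(x, z) \<in> R \<Longrightarrow> z \<noteq> 0" using 1(2) by force
  show "(\<one>, 1) \<in> R" "(x, z) \<in> R \<Longrightarrow> (x', z') \<in> R \<Longrightarrow> (x \<otimes> x', z * z') \<in> R"
    "(x, z) \<in> R \<Longrightarrow> (inv x, inverse z) \<in> R" "(\<one>, z) \<in> R \<Longrightarrow> z = 1"
    using assms by (simp_all add: partial_character_def)
qed

lemma partial_character_int_pow:
  assumes R: "partial_character G R" and xz: "(x, z) \<in> R"
  shows "(x [^] (i::int), z powi i) \<in> R"
proof -
  have nat: "(x [^] (n::nat), z ^ n) \<in> R" for n
    using partial_characterD(4)[OF R] partial_characterD(5)[OF R _ xz]
    by (induction n) (simp_all del: power_Suc add: power_Suc2)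
  show ?thesis
  proof (cases "i \<ge> 0")
    case True
    then show ?thesis using nat[of "nat i"] by (simp add: power_int_def)
  next
    case False
    have "z powi i = inverse (z ^ nat (- i))"
      using False by (simp add: power_int_def power_inverse[symmetric])
    then show ?thesis
      using partial_characterD(6)[OF R nat[of "nat (- i)"]] False by (simp add: int_pow_def2 del: pow_nat)
  qed
qed

lemma partial_character_unique:
  assumes R: "partial_character G R" and "(x, z) \<in> R" "(x, z') \<in> R"
  shows "z = z'"
proof -
  have "(x \<otimes> inv x, z * inverse z') \<in> R"
    using partial_characterD(5)[OF R assms(2) partial_characterD(6)[OF R assms(3)]] .
  moreover have "x \<otimes> inv x = \<one>"
    using partial_characterD(1)[OF R assms(2)] by simp
  ultimately have "z * inverse z' = 1"
    using partial_characterD(7)[OF R] by metis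
  then show ?thesis
    using partial_characterD(3)[OF R assms(3)] by (simp add: field_simps)
qed

lemma subgroup_Domain_partial_character:
  assumes R: "partial_character G R"
  shows "subgroup (Domain R) G"
proof (rule subgroup.intro)
  show "Domain R \<subseteq> carrier G" using partial_characterD(1)[OF R] by blast
  show "\<one> \<in> Domain R" using partial_characterD(4)[OF R] by (rule DomainI)
  show "x \<otimes> y \<in> Domain R" if xy: "x \<in> Domain R" "y \<in> Domain R" for x y
    using xy partial_characterD(5)[OF R] by (elim DomainE) (rule DomainI)
  show "inv x \<in> Domain R" if x: "x \<in> Domain R" for x
    using x partial_characterD(6)[OF R] by (elim DomainE) (rule DomainI)
qed

lemma partial_character_extend:
  assumes R: "partial_character G R" and y: "y \<in> carrier G" and \<theta>: "norm \<theta> = 1"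
    and compat: "\<And>(i::int) z. (y [^] i, z) \<in> R \<Longrightarrow> \<theta> powi i = z"
  obtains R' where "partial_character G R'" "R \<subseteq> R'" "(y, \<theta>) \<in> R'"
    "\<And>x. x \<in> Domain R' \<Longrightarrow> \<exists>a\<in>Domain R. \<exists>i::int. x = a \<otimes> y [^] i"
proof -
  define R' where "R' = {(x \<otimes> y [^] i, z * \<theta> powi i) | x z (i::int). (x, z) \<in> R}"
  have \<theta>0: "\<theta> \<noteq> 0" using \<theta> by auto
  note RD = partial_characterD[OF R]
  have memI: "(x \<otimes> y [^] i, z * \<theta> powi i) \<in> R'" if "(x, z) \<in> R" for x z and i :: int
    using that unfolding R'_def by blast
  have "partial_character G R'"
    unfolding partial_character_def
  proof (intro conjI allI impI)
    fix x z assume "(x, z) \<in> R'"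
    then obtain a w i where *: "(a, w) \<in> R" "x = a \<otimes> y [^] (i::int)" "z = w * \<theta> powi i"
      unfolding R'_def by blast
    then show "x \<in> carrier G" "norm z = 1"
      using RD(1,2)[OF *(1)] y \<theta> by (auto simp: norm_mult norm_power_int)
    have "inv x = inv a \<otimes> y [^] (- i)"
      using * RD(1) y by (simp add: inv_mult int_pow_neg)
    moreover have "inverse z = inverse w * \<theta> powi (- i)"
      using * by (simp add: power_int_minus)
    ultimately show "(inv x, inverse z) \<in> R'"
      using memI[OF RD(6)[OF *(1)]] by simp
    fix x' z' assume "(x', z') \<in> R'"
    then obtain a' w' i' where #: "(a', w') \<in> R" "x' = a' \<otimes> y [^] (i'::int)" "z' = w' * \<theta> powi i'"
      unfolding R'_def by blast
    have "x \<otimes> x' = (a \<otimes> a') \<otimes> y [^] (i + i')"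
      using * # RD(1) y by (simp add: int_pow_mult m_ac)
    moreover have "z * z' = (w * w') * \<theta> powi (i + i')"
      using * # \<theta>0 by (simp add: power_int_add)
    ultimately show "(x \<otimes> x', z * z') \<in> R'"
      using memI[OF RD(5)[OF *(1) #(1)]] by simp
  next
    show "(\<one>, 1) \<in> R'" using memI[OF RD(4), of 0] by simp
  next
    fix z assume "(\<one>, z) \<in> R'"
    then obtain a w i where *: "(a, w) \<in> R" "\<one> = a \<otimes> y [^] (i::int)" "z = w * \<theta> powi i"
      unfolding R'_def by blast
    then have "y [^] i = inv a"
      using RD(1)[OF *(1)] y by (metis inv_equality int_pow_closed m_comm inv_inv)
    then have "\<theta> powi i = inverse w"
      using compat RD(6)[OF *(1)] by simp
    then show "z = 1"
      using * RD(3) by simp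
  qed
  moreover have "R \<subseteq> R'"
  proof
    fix p assume "p \<in> R"
    then show "p \<in> R'"
      using memI[of "fst p" "snd p" 0] RD(1)[of "fst p" "snd p"] by simp
  qed
  moreover have "(y, \<theta>) \<in> R'"
    using memI[OF RD(4), of 1] y by simp
  moreover have "\<exists>a\<in>Domain R. \<exists>i::int. x = a \<otimes> y [^] i" if "x \<in> Domain R'" for x
    using that unfolding R'_def by blast
  ultimately show ?thesis using that by blast
qed

text \<open>
  The values \<open>\<theta>\<close> that a partial character can be given at \<open>y\<close>: all of them if no power of \<open>y\<close> is in
  the domain, and otherwise the \<open>n\<close>-th roots of its value \<open>w\<close> at \<open>y\<^sup>n\<close>, where \<open>n\<close> is the order of
  \<open>y\<close> modulo the domain.
\<close>

lemma partial_character_order_cases: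
  assumes R: "partial_character G R" and y: "y \<in> carrier G"
  obtains (free) "\<And>(i::int) z. (y [^] i, z) \<in> R \<Longrightarrow> i = 0 \<and> z = 1"
  | (torsion) n w where "n > 0" "(y [^] (n::nat), w) \<in> R"
      "\<And>\<theta> (i::int) z. \<theta> ^ n = w \<Longrightarrow> (y [^] i, z) \<in> R \<Longrightarrow> \<theta> powi i = z"
proof (cases "\<exists>n::nat. n > 0 \<and> y [^] n \<in> Domain R")
  case False
  have "i = 0 \<and> z = 1" if "(y [^] i, z) \<in> R" for i :: int and z
  proof -
    have "y [^] (nat \<bar>i\<bar>) \<in> Domain R"
      by (rule int_pow_mem_abs[OF subgroup_Domain_partial_character[OF R] y DomainI[OF that]])
    then have "\<not> nat \<bar>i\<bar> > 0" using False by metis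
    then have "i = 0" by simp
    then show ?thesis using that partial_characterD(7)[OF R] by simp
  qed
  then show ?thesis by (rule free)
next
  case True
  define n where "n = (LEAST n::nat. n > 0 \<and> y [^] n \<in> Domain R)"
  have n: "n > 0" "y [^] n \<in> Domain R"
    using LeastI_ex[OF True] by (auto simp: n_def)
  then obtain w where w: "(y [^] n, w) \<in> R" by blast
  have "\<theta> powi i = z" if th: "\<theta> ^ n = w" and iz: "(y [^] i, z) \<in> R" for \<theta> z and i :: int
  proof -
    define q r where "q = i div int n" and "r = i mod int n"
    have i: "i = int n * q + r" by (simp add: q_def r_def)
    have wq: "(y [^] (int n * q), w powi q) \<in> R"
      using partial_character_int_pow[OF R w, of q] y by (simp add: int_pow_pow flip: int_pow_int)
    have "(y [^] i \<otimes> inv (y [^] (int n * q)), z * inverse (w powi q)) \<in> R"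
      using partial_characterD(5)[OF R iz partial_characterD(6)[OF R wq]] .
    moreover have "y [^] i \<otimes> inv (y [^] (int n * q)) = y [^] r"
      using y i by (simp flip: int_pow_diff)
    ultimately have "y [^] (nat r) \<in> Domain R"
      using n by (auto simp: r_def)
    then have "\<not> (nat r > 0)"
      using not_less_Least[of "nat r" "\<lambda>n. n > 0 \<and> y [^] n \<in> Domain R"] n(1)
      by (auto simp: r_def n_def[symmetric] nat_less_iff)
    then have "r = 0" using n(1) by (simp add: r_def) (metis not_less order_antisym pos_mod_sign of_nat_0_less_iff)
    then have "z = w powi q"
      using partial_character_unique[OF R iz] wq i by simp
    then show ?thesis using th i \<open>r = 0\<close> by (simp add: power_int_mult)
  qed
  then show ?thesis using torsion n(1) w by blast
qed

text \<open>
  The larger the order \<open>n\<close> of \<open>y\<close> modulo the domain, the closer to 1 the new value can be chosen: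
  among the \<open>n\<close>-th roots of a point of the circle, one has an argument of modulus at most \<open>\<pi> / n\<close>.
\<close>

lemma partial_character_extend_close:
  assumes R: "partial_character G R" and y: "y \<in> carrier G"
    and N: "\<And>n. n \<in> {1..N::nat} \<Longrightarrow> y [^] n \<notin> Domain R"
  obtains R' \<theta> where "partial_character G R'" "R \<subseteq> R'" "(y, \<theta>) \<in> R'"
    "norm (\<theta> - 1) \<le> 4 / real (N + 1)"
    "\<And>x. x \<in> Domain R' \<Longrightarrow> \<exists>a\<in>Domain R. \<exists>i::int. x = a \<otimes> y [^] i"
proof -
  have "\<exists>\<theta>. norm \<theta> = 1 \<and> norm (\<theta> - 1) \<le> 4 / real (N + 1) \<and>
          (\<forall>(i::int) z. (y [^] i, z) \<in> R \<longrightarrow> \<theta> powi i = z)"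
    using R y
  proof (cases rule: partial_character_order_cases)
    case free
    then show ?thesis by (intro exI[of _ 1]) auto
  next
    case (torsion n w)
    have "n \<notin> {1..N}"
      using N[of n] torsion(2) by blast
    then have n: "n \<ge> N + 1" using torsion(1) by auto
    define t where "t = Arg w"
    have w: "norm w = 1" "w \<noteq> 0"
      using partial_characterD(2,3)[OF R torsion(2)] by auto
    have t: "cis t = w" "\<bar>t\<bar> \<le> 4"
      using w cis_Arg[of w] mpi_less_Arg[of w] Arg_le_pi[of w] pi_less_4
      by (auto simp: t_def sgn_div_norm)
    define \<theta> where "\<theta> = cis (t / n)"
    have "\<theta> ^ n = w"
      using torsion(1) t Complex.DeMoivre[of "t / n" n] by (simp add: \<theta>_def)
    moreover have "norm (\<theta> - 1) \<le> 4 / real (N + 1)"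
    proof -
      have "norm (\<theta> - 1) \<le> \<bar>t\<bar> / n"
        using norm_cis_minus_1_le[of "t / n"] by (simp add: \<theta>_def)
      also have "\<dots> \<le> 4 / real (N + 1)"
        using t(2) n by (intro frac_le) auto
      finally show ?thesis .
    qed
    ultimately show ?thesis
      using torsion(3) by (intro exI[of _ \<theta>]) (auto simp: \<theta>_def)
  qed
  then show ?thesis
    using partial_character_extend[OF R y] that by metis
qed

lemma partial_character_Union_chain:
  assumes "\<C> \<noteq> {}" "\<And>R. R \<in> \<C> \<Longrightarrow> partial_character G R"
    and "\<And>R R'. R \<in> \<C> \<Longrightarrow> R' \<in> \<C> \<Longrightarrow> R \<subseteq> R' \<or> R' \<subseteq> R"
  shows "partial_character G (\<Union>\<C>)"
  unfolding partial_character_def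
proof (intro conjI allI impI)
  note D = partial_characterD[OF assms(2)]
  show "(\<one>, 1) \<in> \<Union>\<C>" using assms(1) D(4) by blast
  fix x z assume xz: "(x, z) \<in> \<Union>\<C>"
  then show "x \<in> carrier G" "norm z = 1" using D(1,2) by (elim UnionE, simp)+
  show "(inv x, inverse z) \<in> \<Union>\<C>" using xz D(6) by (elim UnionE) (rule UnionI)
  fix x' z' assume "(x', z') \<in> \<Union>\<C>"
  with xz obtain R where "R \<in> \<C>" "(x, z) \<in> R" "(x', z') \<in> R"
    using assms(3) by blast
  then show "(x \<otimes> x', z * z') \<in> \<Union>\<C>" using D(5)[of R] by (intro UnionI)
next
  fix z assume "(\<one>, z) \<in> \<Union>\<C>"
  then show "z = 1" using partial_characterD(7)[OF assms(2)] by blast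
qed

lemma partial_character_extends_to_character:
  assumes R: "partial_character G R"
  obtains \<phi> where "\<phi> \<in> hom G circle_group" "\<And>x z. (x, z) \<in> R \<Longrightarrow> \<phi> x = z"
proof -
  define \<A> where "\<A> = {R'. partial_character G R' \<and> R \<subseteq> R'}"
  have "\<exists>M\<in>\<A>. \<forall>X\<in>\<A>. M \<subseteq> X \<longrightarrow> X = M"
  proof (rule subset_Zorn_nonempty)
    show "\<A> \<noteq> {}" using R by (auto simp: \<A>_def)
    fix \<C> assume C: "\<C> \<noteq> {}" "subset.chain \<A> \<C>"
    then have "partial_character G (\<Union>\<C>)"
      by (intro partial_character_Union_chain) (auto simp: \<A>_def subset_chain_def)
    moreover obtain X where "X \<in> \<C>" "R \<subseteq> X"
      using C by (auto simp: \<A>_def subset_chain_def)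
    then have "R \<subseteq> \<Union>\<C>" by blast
    ultimately show "\<Union>\<C> \<in> \<A>"
      by (simp add: \<A>_def)
  qed
  then obtain M where M: "partial_character G M" "R \<subseteq> M"
    and max: "\<And>X. partial_character G X \<Longrightarrow> R \<subseteq> X \<Longrightarrow> M \<subseteq> X \<Longrightarrow> X = M"
    by (auto simp: \<A>_def)
  have tot: "\<exists>z. (y, z) \<in> M" if y: "y \<in> carrier G" for y
  proof -
    obtain R' \<theta> where R': "partial_character G R'" "M \<subseteq> R'" "(y, \<theta>) \<in> R'"
      by (rule partial_character_extend_close[OF M(1) y, of 0]) simp
    then have "R' = M" using max M(2) by blast
    then show ?thesis using R' by blast
  qed
  define \<phi> where "\<phi> x = (SOME z. (x, z) \<in> M)" for x
  have \<phi>: "(x, \<phi> x) \<in> M" if "x \<in> carrier G" for x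
    unfolding \<phi>_def using someI_ex[OF tot[OF that]] .
  note u = partial_character_unique[OF M(1)] and D = partial_characterD[OF M(1)]
  show ?thesis
  proof
    show "\<phi> \<in> hom G circle_group"
      using D(2)[OF \<phi>] u[OF \<phi> D(5)[OF \<phi> \<phi>]] by (auto simp: hom_def circle_group_def)
    fix x z assume "(x, z) \<in> R"
    then have "(x, z) \<in> M" using M by blast
    then show "\<phi> x = z" using u[OF \<phi>] D(1) by blast
  qed
qed

text \<open>
  The value at \<open>a\<close> can be any root of unity whose order is the order of \<open>a\<close> modulo \<open>A\<close>, or \<open>-1\<close> if
  that order is infinite.
\<close>

lemma exists_separating_character:
  assumes A: "subgroup A G" and a: "a \<in> carrier G" "a \<notin> A"
  obtains \<phi> where "\<phi> \<in> hom G circle_group" "\<And>x. x \<in> A \<Longrightarrow> \<phi> x = 1" "\<phi> a \<noteq> 1"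
proof -
  have R: "partial_character G (A \<times> {1})"
    using subgroup.mem_carrier[OF A] subgroup.one_closed[OF A] subgroup.m_closed[OF A]
      subgroup.m_inv_closed[OF A] by (auto simp: partial_character_def)
  have "\<exists>\<theta>::complex. norm \<theta> = 1 \<and> \<theta> \<noteq> 1 \<and> (\<forall>(i::int) z. (a [^] i, z) \<in> A \<times> {1} \<longrightarrow> \<theta> powi i = z)"
    using R a(1)
  proof (cases rule: partial_character_order_cases)
    case free
    have "(- 1) powi i = z" if "(a [^] i, z) \<in> A \<times> {1}" for i :: int and z :: complex
      using free[OF that] by simp
    then show ?thesis by (intro exI[of _ "-1"]) simp
  next
    case (torsion n w)
    have "n \<noteq> 1" using torsion(2) a by auto
    then have "n \<ge> 2" using torsion(1) by simp
    define \<theta> where "\<theta> = cis (2 * pi / n)"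
    have "\<theta> ^ n = w"
      using torsion(1,2) Complex.DeMoivre[of "2 * pi / n" n] by (simp add: \<theta>_def)
    moreover have "\<theta> \<noteq> 1"
    proof
      assume "\<theta> = 1"
      then have "cos (2 * pi / n) = 1" by (simp add: \<theta>_def complex_eq_iff)
      moreover have "cos (2 * pi / n) < cos 0"
        using \<open>n \<ge> 2\<close> by (intro cos_monotone_0_pi) (auto simp: field_simps)
      ultimately show False by simp
    qed
    ultimately show ?thesis
      using torsion(3) by (intro exI[of _ \<theta>]) (auto simp: \<theta>_def)
  qed
  then obtain \<theta> :: complex where \<theta>: "norm \<theta> = 1" "\<theta> \<noteq> 1"
    "\<And>(i::int) z. (a [^] i, z) \<in> A \<times> {1} \<Longrightarrow> \<theta> powi i = z" by blast
  obtain R' where R': "partial_character G R'" "A \<times> {1} \<subseteq> R'" "(a, \<theta>) \<in> R'"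
    using partial_character_extend[OF R a(1) \<theta>(1,3)] by metis
  obtain \<phi> where "\<phi> \<in> hom G circle_group" "\<And>x z. (x, z) \<in> R' \<Longrightarrow> \<phi> x = z"
    by (rule partial_character_extends_to_character[OF R'(1)]) (rule that)
  then show ?thesis using that R' \<theta>(2) by blast
qed

end

section \<open>Estimates near 1 on the unit circle\<close>

lemma hom_circle_groupD:
  assumes "\<phi> \<in> hom G circle_group"
  shows "x \<in> carrier G \<Longrightarrow> norm (\<phi> x) = 1"
    and "x \<in> carrier G \<Longrightarrow> y \<in> carrier G \<Longrightarrow> \<phi> (x \<otimes>\<^bsub>G\<^esub> y) = \<phi> x * \<phi> y"
  using assms by (auto simp: hom_def circle_group_def Pi_iff)

lemma (in group) hom_circle_group_one:
  assumes "\<phi> \<in> hom G circle_group"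
  shows "\<phi> \<one> = 1"
proof -
  have "\<phi> \<one> * \<phi> \<one> = \<phi> \<one>" "\<phi> \<one> \<noteq> 0"
    using hom_circle_groupD(1)[OF assms one_closed] hom_circle_groupD(2)[OF assms one_closed one_closed]
    by auto
  then show ?thesis by simp
qed

lemma (in group) hom_circle_group_inv:
  assumes "\<phi> \<in> hom G circle_group" "x \<in> carrier G"
  shows "\<phi> (inv x) = inverse (\<phi> x)"
  using hom_circle_groupD(2)[OF assms(1), of x "inv x"] assms hom_circle_group_one[OF assms(1)]
  by (simp add: inverse_unique)

lemma (in group) hom_circle_group_int_pow:
  assumes "\<phi> \<in> hom G circle_group" "x \<in> carrier G"
  shows "\<phi> (x [^] (i::int)) = \<phi> x powi i"
proof -
  have nat: "\<phi> (x [^] (n::nat)) = \<phi> x ^ n" for n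
    using assms by (induction n) (simp_all add: hom_circle_group_one hom_circle_groupD(2)[OF assms(1)])
  show ?thesis
  proof (cases "i \<ge> 0")
    case True
    then show ?thesis using nat[of "nat i"] by (simp add: power_int_def)
  next
    case False
    then show ?thesis
      using nat[of "nat (- i)"] assms
      by (simp add: int_pow_def2 power_int_def hom_circle_group_inv power_inverse del: pow_nat)
  qed
qed

lemma (in comm_group) hom_circle_group_finprod:
  assumes "\<phi> \<in> hom G circle_group" "finite A" "f \<in> A \<rightarrow> carrier G"
  shows "\<phi> (finprod G f A) = (\<Prod>a\<in>A. \<phi> (f a))"
  using assms(2,3)
  by (induction A rule: finite_induct)
    (simp_all add: hom_circle_group_one[OF assms(1)] hom_circle_groupD(2)[OF assms(1)] Pi_iff)

lemma norm_mult_minus_1_le: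
  fixes z w :: complex
  assumes "norm z = 1"
  shows "norm (z * w - 1) \<le> norm (z - 1) + norm (w - 1)"
proof -
  have "z * w - 1 = z * (w - 1) + (z - 1)" by (simp add: algebra_simps)
  then have "norm (z * w - 1) \<le> norm (z * (w - 1)) + norm (z - 1)"
    by (metis norm_triangle_ineq)
  then show ?thesis using assms by (simp add: norm_mult)
qed

lemma norm_inverse_minus_1:
  fixes z :: complex
  assumes "norm z = 1"
  shows "norm (inverse z - 1) = norm (z - 1)"
proof -
  have "z \<noteq> 0" using assms by auto
  then have "inverse z - 1 = inverse z * (1 - z)" by (simp add: algebra_simps)
  then show ?thesis using assms by (simp add: norm_mult norm_inverse norm_minus_commute)
qed

lemma norm_prod_minus_1_le:
  fixes z :: "'i \<Rightarrow> complex"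
  assumes "finite A" "\<And>a. a \<in> A \<Longrightarrow> norm (z a) = 1"
  shows "norm (prod z A - 1) \<le> (\<Sum>a\<in>A. norm (z a - 1))"
  using assms
proof (induction A rule: finite_induct)
  case (insert a A)
  have "norm (prod z (insert a A) - 1) \<le> norm (z a - 1) + norm (prod z A - 1)"
    using insert norm_mult_minus_1_le[of "z a" "prod z A"] by simp
  then show ?case using insert by fastforce
qed simp

lemma norm_power_int_minus_1_le:
  fixes z :: complex
  assumes "norm z = 1"
  shows "norm (z powi i - 1) \<le> real_of_int \<bar>i\<bar> * norm (z - 1)"
proof -
  have nat: "norm (z ^ n - 1) \<le> real n * norm (z - 1)" for n
    using norm_prod_minus_1_le[of "{..<n}" "\<lambda>_. z"] assms by simp
  show ?thesis
  proof (cases "i \<ge> 0")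
    case True
    then show ?thesis using nat[of "nat i"] by (simp add: power_int_def)
  next
    case False
    have "norm (z powi i - 1) = norm (z ^ nat (- i) - 1)"
      using False assms norm_inverse_minus_1[of "z ^ nat (- i)"]
      by (simp add: power_int_def power_inverse norm_power)
    then show ?thesis using nat[of "nat (- i)"] False by simp
  qed
qed

text \<open>
  If \<open>z\<^sup>j\<close> stays near 1 for all \<open>j \<le> N\<close>, then the geometric sum of these powers has real part at
  least \<open>N / 2\<close>, whereas its product with \<open>z - 1\<close> has modulus at most 1.
\<close>

lemma norm_minus_1_le_of_powers:
  fixes z :: complex
  assumes z: "norm z = 1" and N: "N > 0" "\<And>j. j \<le> N \<Longrightarrow> norm (z ^ j - 1) \<le> 1"
  shows "norm (z - 1) \<le> 2 / real N"
proof -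
  have re: "Re (z ^ j) \<ge> 1/2" if "j \<le> N" for j
  proof -
    have "(norm (z ^ j - 1))\<^sup>2 \<le> 1\<^sup>2"
      using N(2)[OF that] by (intro power_mono) auto
    moreover have "(norm (z ^ j - 1))\<^sup>2 = (norm (z ^ j))\<^sup>2 + 1 - 2 * Re (z ^ j)"
      unfolding cmod_power2 by (simp add: power2_eq_square algebra_simps)
    ultimately show ?thesis using z by (simp add: norm_power)
  qed
  have "real N / 2 = (\<Sum>j<N. 1 / 2)" by simp
  also have "\<dots> \<le> (\<Sum>j<N. Re (z ^ j))" using re by (intro sum_mono) auto
  also have "\<dots> \<le> norm (\<Sum>j<N. z ^ j)" by (metis Re_sum complex_Re_le_cmod)
  finally have S: "real N / 2 \<le> norm (\<Sum>j<N. z ^ j)" .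
  have "z ^ N - 1 = (z - 1) * (\<Sum>j<N. z ^ j)" by (rule power_diff_1_eq)
  then have "norm (z - 1) * norm (\<Sum>j<N. z ^ j) \<le> 1"
    using N(2)[of N] by (simp add: norm_mult)
  moreover have "norm (z - 1) * (real N / 2) \<le> norm (z - 1) * norm (\<Sum>j<N. z ^ j)"
    using S by (intro mult_left_mono) auto
  ultimately show ?thesis using N(1) by (simp add: field_simps)
qed


section \<open>The finest group topology in which a sequence of finite sets converges to the identity\<close>

lemma mem_set_mult_iff: "x \<in> P <#>\<^bsub>G\<^esub> Q \<longleftrightarrow> (\<exists>p\<in>P. \<exists>q\<in>Q. x = p \<otimes>\<^bsub>G\<^esub> q)"
  by (auto simp: set_mult_def)

lemma set_multI: "p \<in> P \<Longrightarrow> q \<in> Q \<Longrightarrow> p \<otimes>\<^bsub>G\<^esub> q \<in> P <#>\<^bsub>G\<^esub> Q"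
  by (auto simp: set_mult_def)

lemma l_cosetI: "q \<in> Q \<Longrightarrow> y \<otimes>\<^bsub>G\<^esub> q \<in> y <#\<^bsub>G\<^esub> Q"
  by (auto simp: l_coset_def)

lemma mem_l_coset_iff: "x \<in> y <#\<^bsub>G\<^esub> Q \<longleftrightarrow> (\<exists>q\<in>Q. x = y \<otimes>\<^bsub>G\<^esub> q)"
  by (auto simp: l_coset_def)

text \<open>
  Allowing finite sets \<open>B n\<close> in place of single elements is a convenience: several sequences are made
  to converge at once, and closure under inverses makes all basic neighbourhoods symmetric.
\<close>

locale null_sets = comm_group G for G (structure) +
  fixes B :: "nat \<Rightarrow> 'a set"
  assumes B_carrier: "B n \<subseteq> carrier G"
    and B_finite: "finite (B n)"
    and B_inv: "x \<in> B n \<Longrightarrow> inv x \<in> B n"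
begin

definition tail :: "nat \<Rightarrow> 'a set" where
  "tail n = insert \<one> (\<Union>m\<in>{n..}. B m)"

primrec prods :: "(nat \<Rightarrow> 'a set) \<Rightarrow> nat \<Rightarrow> 'a set" where
  "prods C 0 = {\<one>}"
| "prods C (Suc k) = prods C k <#> C k"

text \<open>
  Protasov and Zelenyuk's base at the identity: products of arbitrarily many factors, the \<open>i\<close>-th of
  which is taken from beyond index \<open>f i\<close>. Every neighbourhood of the identity in a group topology in
  which \<open>B n\<close> converges to the identity contains such a set.
\<close>

definition nbhd :: "(nat \<Rightarrow> nat) \<Rightarrow> 'a set" where
  "nbhd f = (\<Union>k. prods (\<lambda>i. tail (f i)) k)"

definition null_topology :: "'a topology" where
  "null_topology = topology (\<lambda>W. W \<subseteq> carrier G \<and> (\<forall>x\<in>W. \<exists>f. x <# nbhd f \<subseteq> W))"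

lemma tail_carrier: "tail n \<subseteq> carrier G"
  using B_carrier by (auto simp: tail_def)

lemma one_in_tail: "\<one> \<in> tail n"
  by (simp add: tail_def)

lemma tail_inv: "x \<in> tail n \<Longrightarrow> inv x \<in> tail n"
  using B_inv by (auto simp: tail_def)

lemma tail_antimono: "m \<le> n \<Longrightarrow> tail n \<subseteq> tail m"
  by (force simp: tail_def)

lemma prods_carrier: "(\<And>i. C i \<subseteq> carrier G) \<Longrightarrow> prods C k \<subseteq> carrier G"
  by (induction k) (simp_all add: setmult_subset_G)

lemma prods_mono: "(\<And>i. C i \<subseteq> D i) \<Longrightarrow> prods C k \<subseteq> prods D k"
  by (induction k) (simp_all add: mono_set_mult)

lemma prods_mono_length:
  assumes "\<And>i. C i \<subseteq> carrier G" "\<And>i. \<one> \<in> C i" "k \<le> l"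
  shows "prods C k \<subseteq> prods C l"
  using assms(3)
proof (induction l rule: dec_induct)
  case (step l)
  have "x \<in> prods C (Suc l)" if "x \<in> prods C l" for x
  proof -
    have "x = x \<otimes> \<one>" using that prods_carrier[of C l] assms(1) by auto
    then show ?thesis using that assms(2)[of l] by (auto simp: mem_set_mult_iff)
  qed
  then show ?case using step by blast
qed simp

lemma prods_const_mult:
  assumes "C \<subseteq> carrier G" "x \<in> prods (\<lambda>_. C) m" "y \<in> prods (\<lambda>_. C) n"
  shows "x \<otimes> y \<in> prods (\<lambda>_. C) (m + n)"
  using assms(3)
proof (induction n arbitrary: y)
  case 0
  then show ?case using assms prods_carrier[of "\<lambda>_. C" m] by auto
next
  case (Suc n)
  then obtain p q where pq: "p \<in> prods (\<lambda>_. C) n" "q \<in> C" "y = p \<otimes> q"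
    by (auto simp: mem_set_mult_iff)
  then have "x \<otimes> y = (x \<otimes> p) \<otimes> q"
    using assms prods_carrier[of "\<lambda>_. C"] by (subst m_assoc) auto
  then show ?case
    using Suc.IH[OF pq(1)] pq(2) by (auto simp: mem_set_mult_iff)
qed

lemma nbhd_carrier: "nbhd f \<subseteq> carrier G"
  using prods_carrier[of "\<lambda>i. tail (f i)"] tail_carrier by (auto simp: nbhd_def)

lemma one_in_nbhd: "\<one> \<in> nbhd f"
proof -
  have "\<one> \<in> prods (\<lambda>i. tail (f i)) 0" by simp
  then show ?thesis unfolding nbhd_def by blast
qed

lemma nbhd_antimono: "(\<And>i. f i \<le> g i) \<Longrightarrow> nbhd g \<subseteq> nbhd f"
  unfolding nbhd_def by (intro UN_mono prods_mono tail_antimono) auto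

lemma tail_subset_nbhd: "tail (f 0) \<subseteq> nbhd f"
proof -
  have "tail (f 0) \<subseteq> prods (\<lambda>i. tail (f i)) 1"
    using tail_carrier by (force simp: mem_set_mult_iff)
  then show ?thesis unfolding nbhd_def by blast
qed

lemma nbhd_inv:
  assumes "x \<in> nbhd f"
  shows "inv x \<in> nbhd f"
proof -
  have "inv x \<in> prods (\<lambda>i. tail (f i)) k" if "x \<in> prods (\<lambda>i. tail (f i)) k" for k
    using that
  proof (induction k arbitrary: x)
    case (Suc k)
    then obtain p q where pq: "p \<in> prods (\<lambda>i. tail (f i)) k" "q \<in> tail (f k)" "x = p \<otimes> q"
      by (auto simp: mem_set_mult_iff)
    then have "inv x = inv p \<otimes> inv q"
      using tail_carrier prods_carrier[of "\<lambda>i. tail (f i)" k] by (auto intro!: inv_mult)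
    then show ?case
      using Suc.IH[OF pq(1)] tail_inv[OF pq(2)] by (auto simp: mem_set_mult_iff)
  qed simp
  then show ?thesis using assms unfolding nbhd_def by blast
qed

text \<open>
  Two products are interleaved into one, the \<open>i\<close>-th factors going to the positions \<open>2 i\<close> and
  \<open>2 i + 1\<close>.
\<close>

lemma nbhd_halve: "\<exists>g. \<forall>x\<in>nbhd g. \<forall>y\<in>nbhd g. x \<otimes> y \<in> nbhd f"
proof -
  define g where "g i = max (f (2 * i)) (f (2 * i + 1))" for i
  let ?P = "prods (\<lambda>i. tail (g i))" and ?Q = "prods (\<lambda>i. tail (f i))"
  have Pc: "?P k \<subseteq> carrier G" for k using prods_carrier tail_carrier by simp
  have gf: "tail (g k) \<subseteq> tail (f (2 * k))" "tail (g k) \<subseteq> tail (f (Suc (2 * k)))" for k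
    by (simp_all add: g_def tail_antimono)
  have key: "x \<otimes> y \<in> ?Q (2 * k)" if "x \<in> ?P k" "y \<in> ?P k" for x y k
    using that
  proof (induction k arbitrary: x y)
    case (Suc k)
    then obtain p q p' q' where *: "p \<in> ?P k" "q \<in> tail (g k)" "x = p \<otimes> q"
        "p' \<in> ?P k" "q' \<in> tail (g k)" "y = p' \<otimes> q'"
      by (auto simp: mem_set_mult_iff)
    then have "x \<otimes> y = ((p \<otimes> p') \<otimes> q) \<otimes> q'"
      using Pc[of k] tail_carrier[of "g k"] by (auto simp: subset_iff m_ac)
    moreover have "p \<otimes> p' \<in> ?Q (2 * k)" using Suc.IH * by blast
    moreover have "q \<in> tail (f (2 * k))" "q' \<in> tail (f (Suc (2 * k)))"
      using * gf[of k] by blast+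
    ultimately show ?case by (simp add: set_multI)
  qed simp
  have "x \<otimes> y \<in> nbhd f" if xy: "x \<in> nbhd g" "y \<in> nbhd g" for x y
  proof -
    obtain k l where kl: "x \<in> ?P k" "y \<in> ?P l" using xy unfolding nbhd_def by blast
    have "x \<in> ?P (max k l)" "y \<in> ?P (max k l)"
      using kl prods_mono_length[of "\<lambda>i. tail (g i)" _ "max k l"] tail_carrier one_in_tail
      by (meson max.cobounded1 max.cobounded2 subsetD)+
    then show ?thesis using key unfolding nbhd_def by blast
  qed
  then show ?thesis by blast
qed

lemma openin_null_topology:
  "openin null_topology W \<longleftrightarrow> W \<subseteq> carrier G \<and> (\<forall>x\<in>W. \<exists>f. x <# nbhd f \<subseteq> W)"
proof -
  have "istopology (\<lambda>W. W \<subseteq> carrier G \<and> (\<forall>x\<in>W. \<exists>f. x <# nbhd f \<subseteq> W))"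
    unfolding istopology_def
  proof (intro conjI allI impI ballI; (elim conjE)?)
    fix V W x assume VW: "\<forall>x\<in>V. \<exists>f. x <# nbhd f \<subseteq> V" "\<forall>x\<in>W. \<exists>f. x <# nbhd f \<subseteq> W"
      and x: "x \<in> V \<inter> W"
    then obtain f g where fg: "x <# nbhd f \<subseteq> V" "x <# nbhd g \<subseteq> W" by blast
    have "nbhd (\<lambda>i. max (f i) (g i)) \<subseteq> nbhd f \<inter> nbhd g"
      by (simp add: nbhd_antimono)
    then have "x <# nbhd (\<lambda>i. max (f i) (g i)) \<subseteq> V \<inter> W"
      using fg unfolding l_coset_def by blast
    then show "\<exists>f. x <# nbhd f \<subseteq> V \<inter> W" by blast
  next
    fix \<K> x assume K: "\<forall>W\<in>\<K>. W \<subseteq> carrier G \<and> (\<forall>x\<in>W. \<exists>f. x <# nbhd f \<subseteq> W)" and "x \<in> \<Union>\<K>"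
    then obtain W f where "W \<in> \<K>" "x <# nbhd f \<subseteq> W" by blast
    then show "\<exists>f. x <# nbhd f \<subseteq> \<Union>\<K>" by blast
  qed blast+
  then show ?thesis by (simp add: null_topology_def topology_inverse')
qed

lemma topspace_null_topology: "topspace null_topology = carrier G"
proof -
  have "openin null_topology (carrier G)"
    using nbhd_carrier by (fastforce simp: openin_null_topology mem_l_coset_iff)
  then show ?thesis
    by (metis openin_null_topology openin_subset openin_topspace subset_antisym)
qed

lemma nbhd_contains_open: "\<exists>V. openin null_topology V \<and> \<one> \<in> V \<and> V \<subseteq> nbhd f"
proof (intro exI conjI)
  define V where "V = {x \<in> carrier G. \<exists>g. x <# nbhd g \<subseteq> nbhd f}"
  show "openin null_topology V"
    unfolding openin_null_topology
  proof (intro conjI ballI)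
    show "V \<subseteq> carrier G" by (auto simp: V_def)
    fix x assume "x \<in> V"
    then obtain g where g: "x \<in> carrier G" "x <# nbhd g \<subseteq> nbhd f" by (auto simp: V_def)
    obtain h where h: "\<forall>x\<in>nbhd h. \<forall>y\<in>nbhd h. x \<otimes> y \<in> nbhd g" using nbhd_halve by blast
    have "x \<otimes> u \<in> V" if "u \<in> nbhd h" for u
    proof -
      have "(x \<otimes> u) \<otimes> v \<in> nbhd f" if "v \<in> nbhd h" for v
        using that \<open>u \<in> nbhd h\<close> h g nbhd_carrier[of h]
        by (auto simp: m_assoc subset_iff mem_l_coset_iff)
      then show ?thesis
        using g(1) that nbhd_carrier[of h] by (auto simp: V_def mem_l_coset_iff intro!: exI[of _ h])
    qed
    then show "\<exists>f. x <# nbhd f \<subseteq> V" by (auto simp: mem_l_coset_iff intro!: exI[of _ h])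
  qed
  have "\<one> <# nbhd f \<subseteq> nbhd f"
    using nbhd_carrier[of f] by (auto simp: mem_l_coset_iff subset_iff)
  then show "\<one> \<in> V" by (auto simp: V_def)
  show "V \<subseteq> nbhd f"
  proof
    fix x assume "x \<in> V"
    then obtain g where "x \<in> carrier G" "x <# nbhd g \<subseteq> nbhd f" by (auto simp: V_def)
    then show "x \<in> nbhd f"
      using one_in_nbhd[of g] by (metis mem_l_coset_iff r_one subsetD)
  qed
qed

lemma openin_l_coset:
  assumes x: "x \<in> carrier G" and V: "openin null_topology V"
  shows "openin null_topology (x <# V)"
  unfolding openin_null_topology
proof (intro conjI ballI)
  have Vc: "V \<subseteq> carrier G" using V openin_null_topology by blast
  then show "x <# V \<subseteq> carrier G" using x by (auto simp: mem_l_coset_iff subset_iff)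
  fix y assume "y \<in> x <# V"
  then obtain v where v: "v \<in> V" "y = x \<otimes> v" by (auto simp: mem_l_coset_iff)
  then obtain f where f: "v <# nbhd f \<subseteq> V" using V openin_null_topology by blast
  have "y \<otimes> u \<in> x <# V" if u: "u \<in> nbhd f" for u
  proof -
    have "y \<otimes> u = x \<otimes> (v \<otimes> u)" "v \<otimes> u \<in> V"
      using u v f x Vc nbhd_carrier[of f] by (auto simp: m_assoc subset_iff mem_l_coset_iff)
    then show ?thesis by (auto simp: mem_l_coset_iff)
  qed
  then show "\<exists>f. y <# nbhd f \<subseteq> x <# V" by (auto simp: mem_l_coset_iff intro!: exI[of _ f])
qed

lemma coset_nbhd_contains_open:
  assumes "x \<in> carrier G"
  shows "\<exists>V. openin null_topology V \<and> x \<in> V \<and> V \<subseteq> x <# nbhd f"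
proof -
  obtain V where V: "openin null_topology V" "\<one> \<in> V" "V \<subseteq> nbhd f"
    using nbhd_contains_open by blast
  have "x \<in> x <# V" using V(2) assms by (force simp: mem_l_coset_iff)
  moreover have "x <# V \<subseteq> x <# nbhd f" using V(3) unfolding l_coset_def by blast
  ultimately show ?thesis
    using openin_l_coset[OF assms V(1)] by blast
qed

lemma continuous_map_mult:
  "continuous_map (prod_topology null_topology null_topology) null_topology (\<lambda>(x, y). x \<otimes> y)"
  unfolding continuous_map_def
proof (intro conjI allI impI)
  show "(\<lambda>(x, y). x \<otimes> y) \<in> topspace (prod_topology null_topology null_topology) \<rightarrow> topspace null_topology"
    by (auto simp: topspace_null_topology)
  fix W assume W: "openin null_topology W"
  show "openin (prod_topology null_topology null_topology)
      {p \<in> topspace (prod_topology null_topology null_topology). (case p of (x, y) \<Rightarrow> x \<otimes> y) \<in> W}"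
    unfolding openin_prod_topology_alt
  proof (intro allI impI)
    fix x y
    assume "(x, y) \<in> {p \<in> topspace (prod_topology null_topology null_topology).
        (case p of (x, y) \<Rightarrow> x \<otimes> y) \<in> W}"
    then have xy: "x \<in> carrier G" "y \<in> carrier G" "x \<otimes> y \<in> W"
      by (auto simp: topspace_null_topology)
    then obtain f where f: "(x \<otimes> y) <# nbhd f \<subseteq> W" using W openin_null_topology by blast
    obtain g where g: "\<forall>u\<in>nbhd g. \<forall>v\<in>nbhd g. u \<otimes> v \<in> nbhd f" using nbhd_halve by blast
    obtain U where U: "openin null_topology U" "x \<in> U" "U \<subseteq> x <# nbhd g"
      using coset_nbhd_contains_open[OF xy(1)] by blast
    obtain V where V: "openin null_topology V" "y \<in> V" "V \<subseteq> y <# nbhd g"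
      using coset_nbhd_contains_open[OF xy(2)] by blast
    have "u \<otimes> v \<in> W" if "u \<in> U" "v \<in> V" for u v
    proof -
      have "u \<in> x <# nbhd g" "v \<in> y <# nbhd g" using that U V by blast+
      then obtain a b where ab: "a \<in> nbhd g" "b \<in> nbhd g" "u = x \<otimes> a" "v = y \<otimes> b"
        by (auto simp: mem_l_coset_iff)
      then have "a \<in> carrier G" "b \<in> carrier G" using nbhd_carrier by blast+
      then have "u \<otimes> v = (x \<otimes> y) \<otimes> (a \<otimes> b)" using ab xy by (simp add: m_ac)
      moreover have "a \<otimes> b \<in> nbhd f" using g ab by blast
      ultimately show ?thesis using f l_cosetI by (metis subsetD)
    qed
    moreover have "U \<subseteq> carrier G" "V \<subseteq> carrier G" using U V openin_null_topology by blast+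
    ultimately show "\<exists>U V. openin null_topology U \<and> openin null_topology V \<and> x \<in> U \<and> y \<in> V \<and>
        U \<times> V \<subseteq> {p \<in> topspace (prod_topology null_topology null_topology).
          (case p of (x, y) \<Rightarrow> x \<otimes> y) \<in> W}"
      using U V by (intro exI[of _ U] exI[of _ V]) (auto simp: topspace_null_topology)
  qed
qed

lemma group_topology_null_topology: "group_topology G null_topology"
  unfolding group_topology_def
proof (intro conjI topspace_null_topology continuous_map_mult)
  show "continuous_map null_topology null_topology (\<lambda>x. inv x)"
    unfolding continuous_map_def
  proof (intro conjI allI impI)
    show "(\<lambda>x. inv x) \<in> topspace null_topology \<rightarrow> topspace null_topology"
      by (auto simp: topspace_null_topology)
    fix W assume W: "openin null_topology W"
    have "\<exists>f. x <# nbhd f \<subseteq> {x \<in> carrier G. inv x \<in> W}" if x: "x \<in> carrier G" "inv x \<in> W" for x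
    proof -
      obtain f where f: "inv x <# nbhd f \<subseteq> W" using x W openin_null_topology by blast
      have "inv (x \<otimes> u) \<in> W" "x \<otimes> u \<in> carrier G" if "u \<in> nbhd f" for u
        using f x nbhd_inv[OF that] nbhd_carrier[of f] that
        by (auto simp: inv_mult subset_iff mem_l_coset_iff)
      then show ?thesis by (auto simp: mem_l_coset_iff intro!: exI[of _ f])
    qed
    then show "openin null_topology {x \<in> topspace null_topology. inv x \<in> W}"
      by (auto simp: openin_null_topology topspace_null_topology)
  qed
qed

lemma Hausdorff_null_topology:
  assumes "\<And>x. x \<in> carrier G \<Longrightarrow> x \<noteq> \<one> \<Longrightarrow> \<exists>f. x \<notin> nbhd f"
  shows "Hausdorff_space null_topology"
  unfolding Hausdorff_space_def topspace_null_topology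
proof (intro allI impI; elim conjE)
  fix x y assume xy: "x \<in> carrier G" "y \<in> carrier G" "x \<noteq> y"
  have "inv x \<otimes> y \<noteq> \<one>"
    using xy by (metis inv_closed inv_equality inv_inv m_comm)
  then obtain f where f: "inv x \<otimes> y \<notin> nbhd f"
    using assms[of "inv x \<otimes> y"] xy by auto
  obtain g where g: "\<forall>u\<in>nbhd g. \<forall>v\<in>nbhd g. u \<otimes> v \<in> nbhd f" using nbhd_halve by blast
  obtain U where U: "openin null_topology U" "x \<in> U" "U \<subseteq> x <# nbhd g"
    using coset_nbhd_contains_open[OF xy(1)] by blast
  obtain V where V: "openin null_topology V" "y \<in> V" "V \<subseteq> y <# nbhd g"
    using coset_nbhd_contains_open[OF xy(2)] by blast
  have "disjnt U V"
  proof (rule ccontr)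
    assume "\<not> disjnt U V"
    then obtain w where "w \<in> x <# nbhd g" "w \<in> y <# nbhd g"
      using U V unfolding disjnt_def by blast
    then obtain a b where ab: "a \<in> nbhd g" "b \<in> nbhd g" "x \<otimes> a = y \<otimes> b"
      by (auto simp: mem_l_coset_iff)
    then have c: "a \<in> carrier G" "b \<in> carrier G" using nbhd_carrier by blast+
    have "inv x \<otimes> y = inv x \<otimes> (y \<otimes> b) \<otimes> inv b"
      using xy c by (simp add: m_assoc)
    also have "\<dots> = a \<otimes> inv b"
      using xy c by (simp add: ab(3)[symmetric] flip: m_assoc)
    finally show False using f g ab nbhd_inv by auto
  qed
  then show "\<exists>U V. openin null_topology U \<and> openin null_topology V \<and> x \<in> U \<and> y \<in> V \<and> disjnt U V"
    using U V by blast
qed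

text \<open>
  A convergent sequence together with its limit is compact.
\<close>

lemma compactin_tail: "compactin null_topology (tail 0)"
  unfolding compactin_def topspace_null_topology
proof (intro conjI tail_carrier allI impI; elim conjE)
  fix \<U> assume \<U>: "Ball \<U> (openin null_topology)" "tail 0 \<subseteq> \<Union>\<U>"
  then obtain U where U: "U \<in> \<U>" "\<one> \<in> U" using one_in_tail by blast
  then obtain f where "\<one> <# nbhd f \<subseteq> U" using \<U> openin_null_topology by blast
  then have "tail (f 0) \<subseteq> U"
    using tail_subset_nbhd[of f] tail_carrier[of "f 0"] by (force simp: mem_l_coset_iff)
  define D where "D = (\<Union>m<f 0. B m)"
  have "finite D" using B_finite by (simp add: D_def)
  have D: "D \<subseteq> \<Union>\<U>" using \<U>(2) by (auto simp: D_def tail_def)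
  have "tail 0 \<subseteq> tail (f 0) \<union> D"
    unfolding tail_def D_def by (auto simp: Bex_def) (metis not_less)
  obtain \<F> where "finite \<F>" "\<F> \<subseteq> \<U>" "D \<subseteq> \<Union>\<F>"
    using finite_subset_Union[OF \<open>finite D\<close> D] by blast
  then show "\<exists>\<F>. finite \<F> \<and> \<F> \<subseteq> \<U> \<and> tail 0 \<subseteq> \<Union>\<F>"
    using U \<open>tail (f 0) \<subseteq> U\<close> \<open>tail 0 \<subseteq> tail (f 0) \<union> D\<close>
    by (intro exI[of _ "insert U \<F>"]) auto
qed

lemma compactin_set_mult:
  assumes "compactin null_topology P" "compactin null_topology Q"
  shows "compactin null_topology (P <#> Q)"
proof -
  have "P <#> Q = (\<lambda>(x, y). x \<otimes> y) ` (P \<times> Q)"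
    by (auto simp: set_mult_def)
  then show ?thesis
    using image_compactin[OF _ continuous_map_mult] assms by (simp add: compactin_Times)
qed

lemma compactin_prods_tail: "compactin null_topology (prods (\<lambda>_. tail 0) n)"
proof (induction n)
  case 0
  then show ?case by (simp add: topspace_null_topology)
next
  case (Suc n)
  then show ?case by (simp add: compactin_set_mult compactin_tail)
qed

text \<open>
  The first \<open>n\<close> factors lie in a fixed compact set, and only the later ones have to be far out.
\<close>

lemma nbhd_subset_prods_mult:
  assumes "\<And>i. i \<ge> n \<Longrightarrow> f i \<ge> g i"
  shows "nbhd f \<subseteq> prods (\<lambda>_. tail 0) n <#> nbhd g"
proof -
  let ?S = "prods (\<lambda>_. tail 0)" and ?P = "prods (\<lambda>i. tail (g i))" and ?Q = "prods (\<lambda>i. tail (f i))"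
  have Sc: "?S k \<subseteq> carrier G" "?P k \<subseteq> carrier G" for k
    using prods_carrier tail_carrier by simp_all
  have "?Q k \<subseteq> ?S n <#> nbhd g" for k
  proof (cases "k \<le> n")
    case True
    have "?Q k \<subseteq> ?S k" by (intro prods_mono tail_antimono) simp
    also have "?S k \<subseteq> ?S n" using True tail_carrier one_in_tail by (intro prods_mono_length) auto
    finally have "x \<in> ?S n \<and> x = x \<otimes> \<one>" if "x \<in> ?Q k" for x
      using that Sc[of n] by auto
    then show ?thesis
      using one_in_nbhd[of g] unfolding set_mult_def by blast
  next
    case False
    then have "n \<le> k" by simp
    then have "?Q k \<subseteq> ?S n <#> ?P k"
    proof (induction k rule: dec_induct)
      case base
      have "?Q n \<subseteq> ?S n" by (intro prods_mono tail_antimono) simp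
      moreover have "\<one> \<in> ?P n"
        using prods_mono_length[of "\<lambda>i. tail (g i)" 0 n] tail_carrier one_in_tail by auto
      ultimately have "x \<in> ?S n \<and> x = x \<otimes> \<one>" if "x \<in> ?Q n" for x
        using that Sc[of n] by auto
      then show ?case
        using \<open>\<one> \<in> ?P n\<close> unfolding set_mult_def by blast
    next
      case (step k)
      have "?Q (Suc k) \<subseteq> (?S n <#> ?P k) <#> tail (g k)"
        using step assms[of k] by (simp add: mono_set_mult tail_antimono)
      also have "\<dots> = ?S n <#> ?P (Suc k)"
        using set_mult_assoc[OF Sc(1) Sc(2) tail_carrier, of n k "g k"] by simp
      finally show ?case .
    qed
    also have "\<dots> \<subseteq> ?S n <#> nbhd g"
      unfolding nbhd_def by (intro mono_set_mult) auto
    finally show ?thesis .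
  qed
  then show ?thesis unfolding nbhd_def[of f] by blast
qed

lemma cauchy_small_coset:
  assumes F: "group_cauchy_filter G null_topology F"
  shows "\<exists>x\<in>carrier G. \<forall>\<^sub>F z in F. z \<in> x <# nbhd f"
proof -
  have Fb: "F \<noteq> bot" "\<forall>\<^sub>F z in F. z \<in> carrier G"
    using F by (auto simp: group_cauchy_filter_def le_principal)
  obtain V where V: "openin null_topology V" "\<one> \<in> V" "V \<subseteq> nbhd f"
    using nbhd_contains_open by blast
  then have "\<forall>\<^sub>F (x, y) in F \<times>\<^sub>F F. x \<otimes> inv y \<in> V"
    using F by (auto simp: group_cauchy_filter_def)
  then obtain P Q where PQ: "eventually P F" "eventually Q F" "\<And>x y. P x \<Longrightarrow> Q y \<Longrightarrow> x \<otimes> inv y \<in> V"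
    by (auto simp: eventually_prod_filter)
  have "\<forall>\<^sub>F z in F. Q z \<and> z \<in> carrier G" using PQ Fb by (simp add: eventually_conj)
  then obtain y where y: "Q y" "y \<in> carrier G"
    using eventually_happens'[OF Fb(1)] by blast
  have "\<forall>\<^sub>F z in F. z \<in> y <# nbhd f"
    using PQ(1) Fb(2)
  proof eventually_elim
    case (elim z)
    then have "z = y \<otimes> (z \<otimes> inv y)"
      using y by (metis inv_closed m_assoc m_comm r_inv r_one)
    then show ?case using PQ(3)[OF elim(1) y(1)] V(3) by (metis mem_l_coset_iff subsetD)
  qed
  then show ?thesis using y by blast
qed

text \<open>
  The heart of completeness: a Cauchy filter accumulates at one of the compact sets of products of
  length \<open>n\<close>. If each \<open>n\<close> had a neighbourhood \<open>nbhd (\<phi> n)\<close> witnessing the contrary, then a function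
  \<open>f\<close> that dominates all of them diagonally would give a neighbourhood none of whose cosets is in
  the filter.
\<close>

lemma cauchy_near_compact:
  assumes F: "group_cauchy_filter G null_topology F"
  shows "\<exists>x\<in>carrier G. \<exists>n. \<forall>f. \<forall>\<^sub>F z in F. z \<in> (x <# prods (\<lambda>_. tail 0) n) <#> nbhd f"
proof -
  let ?S = "prods (\<lambda>_. tail 0)"
  have Sc: "?S k \<subseteq> carrier G" for k using prods_carrier tail_carrier by simp
  have Fb: "F \<noteq> bot" using F by (auto simp: group_cauchy_filter_def)
  obtain x where x: "x \<in> carrier G" "\<forall>\<^sub>F z in F. z \<in> x <# nbhd (\<lambda>_. 0)"
    using cauchy_small_coset[OF F] by blast
  have "\<exists>n. \<forall>f. \<forall>\<^sub>F z in F. z \<in> (x <# ?S n) <#> nbhd f"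
  proof (rule ccontr)
    assume "\<not> ?thesis"
    then obtain \<phi> where \<phi>: "\<And>n. \<not> (\<forall>\<^sub>F z in F. z \<in> (x <# ?S n) <#> nbhd (\<phi> n))"
      by metis
    \<comment> \<open>The factor 2 leaves room for the centre of a small coset, which is itself a product of some length \<open>n\<close>.\<close>
    define f where "f i = Max ((\<lambda>n. \<phi> (2 * n) i) ` {..i})" for i
    have f: "f i \<ge> \<phi> (2 * n) i" if "i \<ge> n" for i n
      unfolding f_def using that by (intro Max_ge) auto
    obtain y where y: "y \<in> carrier G" "\<forall>\<^sub>F z in F. z \<in> y <# nbhd f"
      using cauchy_small_coset[OF F] by blast
    have "\<exists>z. z \<in> x <# nbhd (\<lambda>_. 0) \<and> z \<in> y <# nbhd f"
      using eventually_happens'[OF Fb eventually_conj[OF x(2) y(2)]] by blast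
    then obtain u v where uv: "u \<in> nbhd (\<lambda>_. 0)" "v \<in> nbhd f" "x \<otimes> u = y \<otimes> v"
      by (auto simp: mem_l_coset_iff)
    then have c: "u \<in> carrier G" "v \<in> carrier G" using nbhd_carrier by blast+
    have "u \<otimes> inv v \<in> nbhd (\<lambda>_. 0)" 
    proof -
      have "inv v \<in> nbhd (\<lambda>_. 0)"
        using nbhd_inv[OF uv(2)] nbhd_antimono[of "\<lambda>_. 0" f] by auto
      then obtain k l where "u \<in> ?S k" "inv v \<in> ?S l"
        using uv(1) by (auto simp: nbhd_def)
      then have "u \<otimes> inv v \<in> ?S (k + l)"
        using prods_const_mult[OF tail_carrier] by blast
      then show ?thesis unfolding nbhd_def by blast
    qed
    then obtain n where n: "u \<otimes> inv v \<in> ?S n" by (auto simp: nbhd_def)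
    have "y = y \<otimes> v \<otimes> inv v" using y c by (simp add: m_assoc)
    also have "\<dots> = x \<otimes> (u \<otimes> inv v)" using x y c by (simp add: uv(3)[symmetric] m_assoc)
    finally have yx: "y = x \<otimes> (u \<otimes> inv v)" .
    have sub: "y <# nbhd f \<subseteq> (x <# ?S (n + n)) <#> nbhd (\<phi> (2 * n))"
    proof
      fix z assume "z \<in> y <# nbhd f"
      then obtain w where w: "w \<in> nbhd f" "z = y \<otimes> w" by (auto simp: mem_l_coset_iff)
      have "w \<in> ?S n <#> nbhd (\<phi> (2 * n))"
        using w(1) nbhd_subset_prods_mult[of n "\<phi> (2 * n)" f] f by blast
      then obtain s t where st: "s \<in> ?S n" "t \<in> nbhd (\<phi> (2 * n))" "w = s \<otimes> t"
        by (auto simp: mem_set_mult_iff)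
      then have c': "s \<in> carrier G" "t \<in> carrier G" using nbhd_carrier Sc by blast+
      have "z = x \<otimes> ((u \<otimes> inv v) \<otimes> s) \<otimes> t"
        using c c' x by (simp add: w(2) st(3) yx m_assoc)
      moreover have "(u \<otimes> inv v) \<otimes> s \<in> ?S (n + n)"
        using prods_const_mult[OF tail_carrier n st(1)] .
      ultimately show "z \<in> (x <# ?S (n + n)) <#> nbhd (\<phi> (2 * n))"
        using st(2) by (simp add: set_multI l_cosetI)
    qed
    have "\<forall>\<^sub>F z in F. z \<in> (x <# ?S (2 * n)) <#> nbhd (\<phi> (2 * n))"
      using y(2) by (rule eventually_mono) (use sub in \<open>auto simp: mult_2\<close>)
    then show False using \<phi> by blast
  qed
  then show ?thesis using x by blast
qed

lemma finite_common_nbhd: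
  assumes "finite I"
  shows "\<exists>f. \<forall>s\<in>I. nbhd f \<subseteq> nbhd (g s)"
  using assms
proof induction
  case (insert s I)
  then obtain f where f: "\<forall>s\<in>I. nbhd f \<subseteq> nbhd (g s)" by blast
  have "nbhd (\<lambda>i. max (f i) (g s i)) \<subseteq> nbhd f \<inter> nbhd (g s)"
    by (simp add: nbhd_antimono)
  then show ?case using f by (intro exI[of _ "\<lambda>i. max (f i) (g s i)"]) auto
qed simp

text \<open>
  A Cauchy filter without a limit avoids a neighbourhood of each point of the compact set \<open>K\<close>, hence,
  by compactness, a uniform neighbourhood of \<open>K\<close>; this contradicts \<open>cauchy_near_compact\<close>.
\<close>

lemma complete_null_topology: "complete_group_topology G null_topology"
  unfolding complete_group_topology_def
proof (intro allI impI)
  fix F assume F: "group_cauchy_filter G null_topology F"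
  then have Fb: "F \<noteq> bot" by (auto simp: group_cauchy_filter_def)
  obtain x n where x: "x \<in> carrier G"
    and xn: "\<And>f. \<forall>\<^sub>F z in F. z \<in> (x <# prods (\<lambda>_. tail 0) n) <#> nbhd f"
    using cauchy_near_compact[OF F] by blast
  define K where "K = x <# prods (\<lambda>_. tail 0) n"
  have K: "compactin null_topology K"
    using compactin_set_mult[OF _ compactin_prods_tail, of "{x}" n] x
    by (simp add: K_def l_coset_eq_set_mult topspace_null_topology)
  then have Kc: "K \<subseteq> carrier G" using compactin_subset_topspace topspace_null_topology by blast
  show "\<exists>l. limitin null_topology (\<lambda>x. x) l F"
  proof (rule ccontr)
    assume no_limit: "\<not> ?thesis"
    have ex: "\<exists>g. \<forall>\<^sub>F z in F. \<forall>u\<in>nbhd g. \<forall>v\<in>nbhd g. z \<noteq> (s \<otimes> u) \<otimes> v" if s: "s \<in> K" for s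
    proof -
      have sc: "s \<in> carrier G" using s Kc by blast
      have "\<not> limitin null_topology (\<lambda>x. x) s F" using no_limit by blast
      then obtain W where W: "openin null_topology W" "s \<in> W" "\<not> (\<forall>\<^sub>F z in F. z \<in> W)"
        using sc by (auto simp: limitin_def topspace_null_topology)
      then obtain f where f: "s <# nbhd f \<subseteq> W" using openin_null_topology by blast
      obtain h where h: "\<forall>u\<in>nbhd h. \<forall>v\<in>nbhd h. u \<otimes> v \<in> nbhd f" using nbhd_halve by blast
      obtain g where g: "\<forall>u\<in>nbhd g. \<forall>v\<in>nbhd g. u \<otimes> v \<in> nbhd h" using nbhd_halve by blast
      obtain y where y: "y \<in> carrier G" "\<forall>\<^sub>F z in F. z \<in> y <# nbhd g"
        using cauchy_small_coset[OF F] by blast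
      have disj: "y \<otimes> w \<noteq> (s \<otimes> u) \<otimes> v" if uvw: "u \<in> nbhd g" "v \<in> nbhd g" "w \<in> nbhd g" for u v w
      proof
        assume eq: "y \<otimes> w = (s \<otimes> u) \<otimes> v"
        have c: "u \<in> carrier G" "v \<in> carrier G" "w \<in> carrier G" using uvw nbhd_carrier by blast+
        have "y = y \<otimes> w \<otimes> inv w" using y c by (simp add: m_assoc)
        then have y': "y = s \<otimes> ((u \<otimes> v) \<otimes> inv w)" using eq sc c by (simp add: m_assoc)
        have "z \<in> W" if z: "z \<in> y <# nbhd g" for z
        proof -
          obtain t where t: "t \<in> nbhd g" "z = y \<otimes> t" using z by (auto simp: mem_l_coset_iff)
          then have tc: "t \<in> carrier G" using nbhd_carrier by blast
          have "z = s \<otimes> ((u \<otimes> v) \<otimes> (inv w \<otimes> t))"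
            using c sc tc by (simp add: t(2) y' m_assoc)
          moreover have "(u \<otimes> v) \<otimes> (inv w \<otimes> t) \<in> nbhd f"
            using g h uvw t(1) nbhd_inv by blast
          ultimately show ?thesis using f l_cosetI by (metis subsetD)
        qed
        then have "\<forall>\<^sub>F z in F. z \<in> W" using y(2) by (auto elim: eventually_mono)
        then show False using W(3) by blast
      qed
      have "\<forall>\<^sub>F z in F. \<forall>u\<in>nbhd g. \<forall>v\<in>nbhd g. z \<noteq> (s \<otimes> u) \<otimes> v"
        using y(2) by (rule eventually_mono) (use disj in \<open>auto simp: mem_l_coset_iff\<close>)
      then show ?thesis by blast
    qed
    from bchoice[OF ballI[OF ex]] obtain g where
      g: "\<forall>s\<in>K. \<forall>\<^sub>F z in F. \<forall>u\<in>nbhd (g s). \<forall>v\<in>nbhd (g s). z \<noteq> (s \<otimes> u) \<otimes> v" ..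
    have "\<forall>s\<in>K. \<exists>V. openin null_topology V \<and> s \<in> V \<and> V \<subseteq> s <# nbhd (g s)"
      using coset_nbhd_contains_open Kc by blast
    from bchoice[OF this] obtain V where
      V: "\<forall>s\<in>K. openin null_topology (V s) \<and> s \<in> V s \<and> V s \<subseteq> s <# nbhd (g s)" ..
    then have "Ball (V ` K) (openin null_topology)" "K \<subseteq> \<Union>(V ` K)" by blast+
    then obtain \<F> where \<F>: "finite \<F>" "\<F> \<subseteq> V ` K" "K \<subseteq> \<Union>\<F>"
      using K unfolding compactin_def by meson
    then obtain I where I: "finite I" "I \<subseteq> K" "\<F> = V ` I"
      using finite_subset_image by metis
    obtain f where f: "\<forall>s\<in>I. nbhd f \<subseteq> nbhd (g s)"
      using finite_common_nbhd[OF I(1)] by blast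
    have "\<forall>\<^sub>F z in F. \<forall>s\<in>I. \<forall>u\<in>nbhd (g s). \<forall>v\<in>nbhd (g s). z \<noteq> (s \<otimes> u) \<otimes> v"
      by (rule eventually_ball_finite) (use g I in blast)+
    then have "\<forall>\<^sub>F z in F. False"
      using xn[of f]
    proof eventually_elim
      case (elim z)
      then obtain k v where k: "k \<in> K" "v \<in> nbhd f" "z = k \<otimes> v"
        by (auto simp: mem_set_mult_iff K_def)
      then obtain s where s: "s \<in> I" "k \<in> V s" using \<F>(3) I(3) by blast
      then have "k \<in> s <# nbhd (g s)" using V I(2) by blast
      then obtain u where u: "u \<in> nbhd (g s)" "k = s \<otimes> u"
        by (auto simp: mem_l_coset_iff)
      then show False using elim s f k by blast
    qed
    then show False using Fb by (simp add: eventually_False)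
  qed
qed

lemma null_topology_not_discrete:
  assumes "\<And>n. B n \<subseteq> {\<one>} \<Longrightarrow> False"
  shows "null_topology \<noteq> discrete_topology (carrier G)"
proof
  assume "null_topology = discrete_topology (carrier G)"
  then have "openin null_topology {\<one>}" by simp
  then obtain f where f: "\<one> <# nbhd f \<subseteq> {\<one>}" by (auto simp: openin_null_topology)
  have "B (f 0) \<subseteq> {\<one>}"
    using f tail_subset_nbhd[of f] B_carrier[of "f 0"] by (force simp: tail_def mem_l_coset_iff)
  then show False using assms by blast
qed

end

section \<open>Continuous characters\<close>

context null_sets
begin

lemma character_small_on_tail:
  assumes \<phi>: "\<phi> \<in> characters G null_topology" and "\<epsilon> > 0"
  shows "\<exists>n. \<forall>b\<in>tail n. norm (\<phi> b - 1) < \<epsilon>"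
proof -
  have hom: "\<phi> \<in> hom G circle_group" and cont: "continuous_map null_topology euclidean \<phi>"
    using \<phi> by (auto simp: characters_def continuous_map_in_subtopology)
  have "openin null_topology {x \<in> topspace null_topology. \<phi> x \<in> ball 1 \<epsilon>}"
    using cont by (rule openin_continuous_map_preimage) simp
  moreover have "\<one> \<in> {x \<in> topspace null_topology. \<phi> x \<in> ball 1 \<epsilon>}"
    using hom_circle_group_one[OF hom] \<open>\<epsilon> > 0\<close> by (simp add: topspace_null_topology)
  ultimately obtain f where f: "\<one> <# nbhd f \<subseteq> {x \<in> topspace null_topology. \<phi> x \<in> ball 1 \<epsilon>}"
    unfolding openin_null_topology by blast
  have "norm (\<phi> b - 1) < \<epsilon>" if "b \<in> tail (f 0)" for b
  proof -
    have "b \<in> nbhd f" "b \<in> carrier G" using that tail_subset_nbhd tail_carrier by blast+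
    then have "b \<in> \<one> <# nbhd f" using l_cosetI[where q = b and Q = "nbhd f" and y = \<one> and G = G] by simp
    then show ?thesis using f by (auto simp: dist_norm norm_minus_commute)
  qed
  then show ?thesis by blast
qed

text \<open>
  The \<open>i\<close>-th factor is taken so far out that its contribution is below \<open>\<epsilon> / 2\<^sup>i\<^sup>+\<^sup>1\<close>; then arbitrarily
  long products stay within \<open>\<epsilon>\<close> of 1.
\<close>

lemma characterI_small_on_tail:
  assumes hom: "\<phi> \<in> hom G circle_group"
    and small: "\<And>\<epsilon>. \<epsilon> > 0 \<Longrightarrow> \<exists>n. \<forall>b\<in>tail n. norm (\<phi> b - 1) < \<epsilon>"
  shows "\<phi> \<in> characters G null_topology"
proof -
  note homD = hom_circle_groupD[OF hom]
  have nb: "\<exists>f. \<forall>u\<in>nbhd f. norm (\<phi> u - 1) < \<epsilon>" if "\<epsilon> > 0" for \<epsilon>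
  proof -
    have "\<exists>n. \<forall>b\<in>tail n. norm (\<phi> b - 1) < \<epsilon> / 2 ^ (i + 1)" for i :: nat
      using small \<open>\<epsilon> > 0\<close> by simp
    then obtain f where f: "\<And>i b. b \<in> tail (f i) \<Longrightarrow> norm (\<phi> b - 1) < \<epsilon> / 2 ^ (i + 1)"
      by metis
    have "norm (\<phi> x - 1) \<le> \<epsilon> - \<epsilon> / 2 ^ k \<and> (k > 0 \<longrightarrow> norm (\<phi> x - 1) < \<epsilon>)"
      if "x \<in> prods (\<lambda>i. tail (f i)) k" for x k
      using that
    proof (induction k arbitrary: x)
      case 0
      then show ?case using hom_circle_group_one[OF hom] by simp
    next
      case (Suc k)
      then obtain p q where pq: "p \<in> prods (\<lambda>i. tail (f i)) k" "q \<in> tail (f k)" "x = p \<otimes> q"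
        by (auto simp: mem_set_mult_iff)
      have c: "p \<in> carrier G" "q \<in> carrier G"
        using pq prods_carrier[of "\<lambda>i. tail (f i)"] tail_carrier by blast+
      have "norm (\<phi> x - 1) \<le> norm (\<phi> p - 1) + norm (\<phi> q - 1)"
        using norm_mult_minus_1_le[OF homD(1)[OF c(1)]] homD(2)[OF c] pq(3) by simp
      also have "\<dots> < (\<epsilon> - \<epsilon> / 2 ^ k) + \<epsilon> / 2 ^ (k + 1)"
        using Suc.IH[OF pq(1)] f[OF pq(2)] by linarith
      also have "\<dots> = \<epsilon> - \<epsilon> / 2 ^ Suc k" by (simp add: field_simps)
      finally have "norm (\<phi> x - 1) < \<epsilon> - \<epsilon> / 2 ^ Suc k" .
      moreover have "\<epsilon> / 2 ^ Suc k > 0" using \<open>\<epsilon> > 0\<close> by simp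
      ultimately show ?case by linarith
    qed
    then have "norm (\<phi> u - 1) < \<epsilon>" if "u \<in> nbhd f" for u
    proof -
      obtain k where k: "u \<in> prods (\<lambda>i. tail (f i)) k" using \<open>u \<in> nbhd f\<close> unfolding nbhd_def by blast
      have "\<epsilon> / 2 ^ k > 0" using \<open>\<epsilon> > 0\<close> by simp
      then show ?thesis
        using \<open>\<And>x k. x \<in> prods (\<lambda>i. tail (f i)) k \<Longrightarrow> _\<close>[OF k] by linarith
    qed
    then show ?thesis by blast
  qed
  have "openin null_topology {x \<in> topspace null_topology. \<phi> x \<in> W}" if W: "open W" for W
    unfolding openin_null_topology topspace_null_topology
  proof (intro conjI ballI)
    fix x assume "x \<in> {x \<in> carrier G. \<phi> x \<in> W}"
    then obtain \<epsilon> where x: "x \<in> carrier G" "\<epsilon> > 0" "ball (\<phi> x) \<epsilon> \<subseteq> W"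
      using W open_contains_ball by blast
    then obtain f where f: "\<And>u. u \<in> nbhd f \<Longrightarrow> norm (\<phi> u - 1) < \<epsilon>" using nb by blast
    have "x \<otimes> u \<in> carrier G \<and> \<phi> (x \<otimes> u) \<in> W" if u: "u \<in> nbhd f" for u
    proof -
      have uc: "u \<in> carrier G" using u nbhd_carrier by blast
      have "\<phi> (x \<otimes> u) - \<phi> x = \<phi> x * (\<phi> u - 1)"
        using homD(2)[OF x(1) uc] by (simp add: algebra_simps)
      then have "dist (\<phi> (x \<otimes> u)) (\<phi> x) < \<epsilon>"
        using homD(1)[OF x(1)] f[OF u] by (simp add: dist_norm norm_mult)
      then have "\<phi> (x \<otimes> u) \<in> ball (\<phi> x) \<epsilon>" by (simp add: dist_commute)
      then show ?thesis using x uc by auto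
    qed
    then show "\<exists>f. x <# nbhd f \<subseteq> {x \<in> carrier G. \<phi> x \<in> W}"
      by (auto simp: mem_l_coset_iff intro!: exI[of _ f])
  qed auto
  then have "continuous_map null_topology euclidean \<phi>"
    by (simp add: continuous_map_def)
  then show ?thesis
    using hom homD(1) by (auto simp: characters_def continuous_map_in_subtopology topspace_null_topology)
qed

end

section \<open>Sequences of elements of rapidly growing order\<close>

text \<open>
  The dyadic blocks \<open>{2\<^sup>m - 1..<2\<^sup>m\<^sup>+\<^sup>1 - 1}\<close> partition the natural numbers, and the block containing
  \<open>l\<close> is computed by \<^const>\<open>floor_log\<close>. Block \<open>m\<close> has more than \<open>m\<close> elements and starts at or
  after \<open>m\<close>.
\<close>

definition block :: "nat \<Rightarrow> nat set" where
  "block m = {l. floor_log (Suc l) = m}"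

lemma block_bounds:
  assumes "l \<in> block m"
  shows "2 ^ m \<le> Suc l" "Suc l < 2 * 2 ^ m" "m \<le> l"
proof -
  show 1: "2 ^ m \<le> Suc l" "Suc l < 2 * 2 ^ m"
    using assms floor_log_exp2_le[of "Suc l"] floor_log_exp2_gt[of "Suc l"] by (auto simp: block_def)
  have "m < 2 ^ m" by simp
  then show "m \<le> l" using 1 by linarith
qed

lemma block_eq: "block m = {2 ^ m - 1..<2 * 2 ^ m - 1}"
proof (intro equalityI subsetI)
  fix l assume "l \<in> block m"
  then show "l \<in> {2 ^ m - 1..<2 * 2 ^ m - 1}" using block_bounds[of l m] by auto
next
  fix l assume "l \<in> {2 ^ m - 1..<2 * 2 ^ m - 1 :: nat}"
  then show "l \<in> block m" unfolding block_def by (auto intro!: floor_log_eqI)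
qed

lemma card_block: "card (block m) = 2 ^ m"
  by (simp add: block_eq)

lemma finite_block: "finite (block m)"
  by (simp add: block_eq)

lemma (in comm_group) finprod_int_pow:
  assumes "finite A" "f \<in> A \<rightarrow> carrier G"
  shows "finprod G f A [^] (s::int) = finprod G (\<lambda>a. f a [^] s) A"
  using assms by (induction A rule: finite_induct) (auto simp: Pi_iff int_pow_distrib)

lemma (in comm_group) finprod_in_subgroup:
  assumes "subgroup K G" "finite A" "\<And>a. a \<in> A \<Longrightarrow> f a \<in> K"
  shows "finprod G f A \<in> K"
  using assms(2,3)
proof (induction A rule: finite_induct)
  case (insert a A)
  then have "f \<in> A \<rightarrow> carrier G" "f a \<in> carrier G"
    using subgroup.mem_carrier[OF assms(1)] by auto
  then show ?case
    using insert subgroup.m_closed[OF assms(1)] by simp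
qed (simp add: subgroup.one_closed[OF assms(1)])

text \<open>
  The bound on the order of \<open>y k\<close> exceeds the exponents with which \<open>y k\<close> can occur in an element of a
  small neighbourhood: at most \<open>k + 1\<close> of its factors have an index \<open>\<le> k\<close>, and each contributes
  at most \<open>(k + 1)\<^sup>2\<close>, or 1 through the block containing \<open>k\<close>.
\<close>

locale spread_sequence = comm_group G for G (structure) +
  fixes h y :: "nat \<Rightarrow> 'a" and F :: "nat \<Rightarrow> 'a set"
  assumes h_carrier: "h k \<in> carrier G"
    and y_carrier: "y k \<in> carrier G"
    and F_subgroup: "subgroup (F k) G"
    and F_Suc: "F k \<subseteq> F (Suc k)"
    and h_mem: "h k \<in> F k"
    and y_mem: "y k \<in> F (Suc k)"
    and order: "n \<in> {1..2 * Suc k ^ 3} \<Longrightarrow> y k [^] (n::nat) \<notin> F k"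
begin

definition d :: "nat \<Rightarrow> 'a" where
  "d m = h m \<otimes> finprod G y (block m)"

definition B :: "nat \<Rightarrow> 'a set" where
  "B m = {y m [^] j | j::int. \<bar>j\<bar> \<le> int ((Suc m)\<^sup>2)} \<union> {d m, inv (d m)}"

lemma d_carrier: "d m \<in> carrier G"
  using h_carrier y_carrier by (simp add: d_def Pi_iff)

sublocale null_sets G B
proof
  fix n
  show "B n \<subseteq> carrier G" using y_carrier d_carrier by (auto simp: B_def)
  have "{y n [^] j | j::int. \<bar>j\<bar> \<le> int ((Suc n)\<^sup>2)} = (\<lambda>j. y n [^] j) ` {- int ((Suc n)\<^sup>2)..int ((Suc n)\<^sup>2)}"
    by (auto simp: abs_le_iff)
  then show "finite (B n)" by (simp add: B_def)
  fix x assume x: "x \<in> B n"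
  show "inv x \<in> B n"
  proof (cases "x \<in> {d n, inv (d n)}")
    case True
    then show ?thesis using d_carrier by (auto simp: B_def)
  next
    case False
    then obtain j :: int where j: "x = y n [^] j" "\<bar>j\<bar> \<le> int ((Suc n)\<^sup>2)"
      using x by (auto simp: B_def)
    then have "inv x = y n [^] (- j)" using y_carrier by (simp add: int_pow_neg)
    moreover have "\<bar>- j\<bar> \<le> int ((Suc n)\<^sup>2)" using j by simp
    ultimately show ?thesis unfolding B_def by blast
  qed
qed

lemma F_mono: "j \<le> k \<Longrightarrow> F j \<subseteq> F k"
  by (rule lift_Suc_mono_le[of F]) (use F_Suc in auto)

text \<open>
  Products of powers \<open>y l\<^bsup>b l\<^esup>\<close> and \<open>d m\<^bsup>e m\<^esup>\<close>, after expanding \<open>d m\<close>: the exponent of \<open>y l\<close> then also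
  receives the exponent of the \<open>d m\<close> whose block contains \<open>l\<close>.
\<close>

definition comb :: "nat \<Rightarrow> (nat \<Rightarrow> int) \<Rightarrow> (nat \<Rightarrow> int) \<Rightarrow> 'a" where
  "comb L b e = finprod G (\<lambda>l. y l [^] (b l + e (floor_log (Suc l)))) {..<L} \<otimes>
     finprod G (\<lambda>m. h m [^] e m) {..<L}"

text \<open>
  The length \<open>L\<close> of the product is immaterial once it is large; requiring the equation for all large
  \<open>L\<close> makes representations multiplicative without comparing lengths.
\<close>

definition represents :: "(nat \<Rightarrow> int) \<Rightarrow> (nat \<Rightarrow> int) \<Rightarrow> 'a \<Rightarrow> bool" where
  "represents b e x \<longleftrightarrow> (\<exists>L0. (\<forall>l\<ge>L0. b l = 0 \<and> e l = 0) \<and> (\<forall>L\<ge>L0. x = comb L b e))"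

lemma comb_add: "comb L (\<lambda>l. b l + b' l) (\<lambda>l. e l + e' l) = comb L b e \<otimes> comb L b' e'"
proof -
  have "finprod G (\<lambda>l. y l [^] (b l + b' l + (e (floor_log (Suc l)) + e' (floor_log (Suc l))))) {..<L}
      = finprod G (\<lambda>l. y l [^] (b l + e (floor_log (Suc l))) \<otimes> y l [^] (b' l + e' (floor_log (Suc l)))) {..<L}"
    using y_carrier by (intro finprod_cong') (auto simp: add_ac simp flip: int_pow_mult)
  moreover have "finprod G (\<lambda>m. h m [^] (e m + e' m)) {..<L}
      = finprod G (\<lambda>m. h m [^] e m \<otimes> h m [^] e' m) {..<L}"
    using h_carrier by (intro finprod_cong') (auto simp flip: int_pow_mult)
  ultimately show ?thesis
    unfolding comb_def using y_carrier h_carrier by (simp add: m_ac Pi_iff)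
qed

lemma represents_mult:
  assumes "represents b e x" "represents b' e' x'"
  shows "represents (\<lambda>l. b l + b' l) (\<lambda>l. e l + e' l) (x \<otimes> x')"
proof -
  obtain L0 where L0: "\<forall>l\<ge>L0. b l = 0 \<and> e l = 0" "\<forall>L\<ge>L0. x = comb L b e"
    using assms(1) unfolding represents_def by blast
  obtain L1 where L1: "\<forall>l\<ge>L1. b' l = 0 \<and> e' l = 0" "\<forall>L\<ge>L1. x' = comb L b' e'"
    using assms(2) unfolding represents_def by blast
  show ?thesis
    unfolding represents_def comb_add
  proof (intro exI[of _ "max L0 L1"] conjI allI impI)
    fix L assume "L \<ge> max L0 L1"
    then have "x = comb L b e" "x' = comb L b' e'" using L0(2) L1(2) by auto
    then show "x \<otimes> x' = comb L b e \<otimes> comb L b' e'" by metis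
  qed (use L0(1) L1(1) in auto)
qed

lemma represents_one: "represents (\<lambda>_. 0) (\<lambda>_. 0) \<one>"
  unfolding represents_def comb_def by simp

lemma represents_y: "represents (\<lambda>l. if l = m then j else 0) (\<lambda>_. 0) (y m [^] j)"
  unfolding represents_def
proof (intro exI[of _ "Suc m"] conjI allI impI)
  fix L assume L: "L \<ge> Suc m"
  have "finprod G (\<lambda>l. y l [^] ((if l = m then j else 0) + 0)) {..<L}
      = finprod G (\<lambda>l. if m = l then y l [^] j else \<one>) {..<L}"
    using y_carrier by (intro finprod_cong') auto
  also have "\<dots> = y m [^] j"
    using L y_carrier by (intro finprod_singleton) auto
  finally show "y m [^] j = comb L (\<lambda>l. if l = m then j else 0) (\<lambda>_. 0)"
    using y_carrier by (simp add: comb_def)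
qed auto

lemma represents_d: "represents (\<lambda>_. 0) (\<lambda>i. if i = m then s else 0) (d m [^] s)"
  unfolding represents_def
proof (intro exI[of _ "2 * 2 ^ m"] conjI allI impI)
  have m: "m < 2 * 2 ^ m" using less_exp[of m] by linarith
  show "(if l = m then s else 0) = 0" if "l \<ge> 2 * 2 ^ m" for l
    using that m by auto
  fix L :: nat assume L: "L \<ge> 2 * 2 ^ m"
  have "finprod G (\<lambda>l. y l [^] s) (block m)
      = finprod G (\<lambda>l. y l [^] (0 + (if floor_log (Suc l) = m then s else 0))) {..<L}"
  proof (rule finprod_mono_neutral_cong_left)
    show "block m \<subseteq> {..<L}" using block_bounds(2)[of _ m] L by fastforce
  qed (use y_carrier in \<open>auto simp: block_def\<close>)
  moreover have "finprod G (\<lambda>i. h i [^] (if i = m then s else 0)) {..<L}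
      = finprod G (\<lambda>i. if m = i then h i [^] s else \<one>) {..<L}"
    using h_carrier by (intro finprod_cong') auto
  moreover have "\<dots> = h m [^] s"
    using L m h_carrier by (intro finprod_singleton) auto
  moreover have "finprod G y (block m) [^] s = finprod G (\<lambda>l. y l [^] s) (block m)"
    using y_carrier finite_block by (intro finprod_int_pow) auto
  moreover have "d m [^] s = h m [^] s \<otimes> finprod G y (block m) [^] s"
    using h_carrier y_carrier by (simp add: d_def int_pow_distrib Pi_iff)
  ultimately show "d m [^] s = comb L (\<lambda>_. 0) (\<lambda>i. if i = m then s else 0)"
    using h_carrier y_carrier by (simp add: comb_def m_comm Pi_iff)
qed simp

lemma tail_represented:
  assumes "q \<in> tail n"
  shows "\<exists>b e l. represents b e q \<and> l \<ge> n \<and> (\<forall>i. i \<noteq> l \<longrightarrow> b i = 0 \<and> e i = 0) \<and>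
    \<bar>b l\<bar> \<le> int ((Suc l)\<^sup>2) \<and> \<bar>e l\<bar> \<le> 1"
proof -
  consider "q = \<one>" | m where "m \<ge> n" "q \<in> B m"
    using assms unfolding tail_def by auto
  then show ?thesis
  proof cases
    case 1
    then show ?thesis
      using represents_one by (intro exI[of _ "\<lambda>_. 0"] exI[of _ n]) simp
  next
    case (2 m)
    then consider j :: int where "q = y m [^] j" "\<bar>j\<bar> \<le> int ((Suc m)\<^sup>2)" | s :: int where "q = d m [^] s" "\<bar>s\<bar> \<le> 1"
    proof -
      have "d m = d m [^] (1::int)" "inv (d m) = d m [^] (-1::int)"
        using d_carrier by (simp_all add: int_pow_neg)
      moreover assume "\<And>j::int. \<lbrakk>q = y m [^] j; \<bar>j\<bar> \<le> int ((Suc m)\<^sup>2)\<rbrakk> \<Longrightarrow> thesis"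
        "\<And>s::int. \<lbrakk>q = d m [^] s; \<bar>s\<bar> \<le> 1\<rbrakk> \<Longrightarrow> thesis"
      ultimately show thesis using 2(2) unfolding B_def by force
    qed
    then show ?thesis
    proof cases
      case (1 j)
      then show ?thesis
        using represents_y[of m j] 2(1)
        by (intro exI[of _ "\<lambda>l. if l = m then j else 0"] exI[of _ "\<lambda>_. 0"] exI[of _ m]) auto
    next
      case (2 s)
      then show ?thesis
        using represents_d[of m s] \<open>m \<ge> n\<close>
        by (intro exI[of _ "\<lambda>_. 0"] exI[of _ "\<lambda>l. if l = m then s else 0"] exI[of _ m]) auto
    qed
  qed
qed

text \<open>
  Besides the sizes of the exponents, the number of nonzero \<open>b l\<close> is controlled, since each factor
  changes at most one of them. This is what prevents the cancellation of a whole block.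
\<close>

lemma prods_represented:
  assumes "x \<in> prods (\<lambda>i. tail (f i)) K"
  shows "\<exists>b e. represents b e x \<and>
    (\<forall>l. \<bar>b l\<bar> \<le> int ((Suc l)\<^sup>2) * int (card {i. i < K \<and> f i \<le> l})) \<and>
    (\<forall>l. \<bar>e l\<bar> \<le> int (card {i. i < K \<and> f i \<le> l})) \<and>
    (\<forall>n. card {l. l < n \<and> b l \<noteq> 0} \<le> card {i. i < K \<and> f i < n})"
  using assms
proof (induction K arbitrary: x)
  case 0
  then show ?case
    using represents_one by (intro exI[of _ "\<lambda>_. 0"]) simp
next
  case (Suc K)
  then obtain p q where pq: "p \<in> prods (\<lambda>i. tail (f i)) K" "q \<in> tail (f K)" "x = p \<otimes> q"
    by (auto simp: mem_set_mult_iff)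
  obtain b e where be: "represents b e p"
    "\<And>l. \<bar>b l\<bar> \<le> int ((Suc l)\<^sup>2) * int (card {i. i < K \<and> f i \<le> l})"
    "\<And>l. \<bar>e l\<bar> \<le> int (card {i. i < K \<and> f i \<le> l})"
    "\<And>n. card {l. l < n \<and> b l \<noteq> 0} \<le> card {i. i < K \<and> f i < n}"
    using Suc.IH[OF pq(1)] by blast
  obtain b' e' l' where be': "represents b' e' q" "l' \<ge> f K"
    "\<And>i. i \<noteq> l' \<Longrightarrow> b' i = 0 \<and> e' i = 0" "\<bar>b' l'\<bar> \<le> int ((Suc l')\<^sup>2)" "\<bar>e' l'\<bar> \<le> 1"
    using tail_represented[OF pq(2)] by blast
  have card: "card {i. i < Suc K \<and> P (f i)} = card {i. i < K \<and> P (f i)} + (if P (f K) then 1 else 0)" for P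
  proof -
    have "{i. i < Suc K \<and> P (f i)} = (if P (f K) then insert K {i. i < K \<and> P (f i)} else {i. i < K \<and> P (f i)})"
      by (auto simp: less_Suc_eq)
    then show ?thesis by simp
  qed
  have "\<bar>b l + b' l\<bar> \<le> int ((Suc l)\<^sup>2) * int (card {i. i < Suc K \<and> f i \<le> l})" for l
  proof (cases "l = l'")
    case True
    then have "card {i. i < Suc K \<and> f i \<le> l} = card {i. i < K \<and> f i \<le> l} + 1"
      using card[of "\<lambda>j. j \<le> l"] be'(2) by simp
    moreover have "\<bar>b' l\<bar> \<le> int ((Suc l)\<^sup>2)" unfolding True by (rule be'(4))
    then have "\<bar>b l + b' l\<bar> \<le> int ((Suc l)\<^sup>2) * int (card {i. i < K \<and> f i \<le> l}) + int ((Suc l)\<^sup>2)"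
      using be(2)[of l] by linarith
    ultimately show ?thesis by (simp add: algebra_simps)
  next
    case False
    have "int ((Suc l)\<^sup>2) * int (card {i. i < K \<and> f i \<le> l})
        \<le> int ((Suc l)\<^sup>2) * int (card {i. i < Suc K \<and> f i \<le> l})"
      using card[of "\<lambda>j. j \<le> l"] by (intro mult_left_mono) auto
    then have "\<bar>b l\<bar> \<le> int ((Suc l)\<^sup>2) * int (card {i. i < Suc K \<and> f i \<le> l})"
      using be(2)[of l] by linarith
    moreover have "b l + b' l = b l" using be'(3)[OF False] by simp
    ultimately show ?thesis by metis
  qed
  moreover have "\<bar>e l + e' l\<bar> \<le> int (card {i. i < Suc K \<and> f i \<le> l})" for l
    using be(3)[of l] be'(2,3,5) card[of "\<lambda>j. j \<le> l"] by (cases "l = l'") auto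
  moreover have "card {l. l < n \<and> b l + b' l \<noteq> 0} \<le> card {i. i < Suc K \<and> f i < n}" for n
  proof (cases "l' < n")
    case True
    have "{l. l < n \<and> b l + b' l \<noteq> 0} \<subseteq> insert l' {l. l < n \<and> b l \<noteq> 0}"
      using be'(3) by force
    then have "card {l. l < n \<and> b l + b' l \<noteq> 0} \<le> card (insert l' {l. l < n \<and> b l \<noteq> 0})"
      by (intro card_mono) auto
    also have "\<dots> \<le> Suc (card {l. l < n \<and> b l \<noteq> 0})" by (simp add: card_insert_if)
    finally show ?thesis using be(4)[of n] be'(2) True card[of "\<lambda>j. j < n"] by simp
  next
    case False
    then have "{l. l < n \<and> b l + b' l \<noteq> 0} = {l. l < n \<and> b l \<noteq> 0}"
      using be'(3) by force
    then show ?thesis using be(4)[of n] card[of "\<lambda>j. j < n"] by simp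
  qed
  ultimately show ?case
    using represents_mult[OF be(1) be'(1)] pq(3)
    by (intro exI[of _ "\<lambda>l. b l + b' l"] exI[of _ "\<lambda>l. e l + e' l"]) simp
qed

lemma nbhd_subset_F: "nbhd f \<subseteq> (\<Union>k. F k)"
proof
  fix x assume "x \<in> nbhd f"
  then obtain K where "x \<in> prods (\<lambda>i. tail (f i)) K" unfolding nbhd_def by blast
  then obtain b e where "represents b e x" using prods_represented by blast
  then obtain L where L: "x = comb L b e" unfolding represents_def by blast
  have "y l [^] (i::int) \<in> F L" "h l [^] i \<in> F L" if "l < L" for l i
  proof -
    have "y l \<in> F L" "h l \<in> F L"
      using that y_mem[of l] h_mem[of l] F_mono[of "Suc l" L] F_mono[of l L] by auto
    then show "y l [^] i \<in> F L" "h l [^] i \<in> F L"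
      using subgroup_int_pow_closed[OF F_subgroup] by blast+
  qed
  then have "x \<in> F L"
    unfolding L comb_def
    by (intro subgroup.m_closed[OF F_subgroup] finprod_in_subgroup[OF F_subgroup]) auto
  then show "x \<in> (\<Union>k. F k)" by blast
qed

text \<open>
  By the last hypothesis each \<open>d m\<close> that occurs leaves some \<open>y l\<close> of its block uncancelled. So if the
  representation is nontrivial, there is a largest \<open>k\<close> for which the total exponent \<open>c k\<close> of
  \<open>y k\<close> is nonzero, and every \<open>h m\<close> that occurs has \<open>m \<le> k\<close>. All other factors and \<open>x\<close> lie in \<open>F k\<close>;
  hence so does \<open>y k\<^bsup>c k\<^esup>\<close>, against the choice of \<open>y k\<close>.
\<close>

lemma trivial_of_represented:
  assumes x: "x \<in> F k0" and rep: "represents b e x"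
    and low: "\<And>l. l < k0 \<Longrightarrow> b l = 0 \<and> e l = 0"
    and size: "\<And>l. \<bar>b l\<bar> + \<bar>e (floor_log (Suc l))\<bar> \<le> 2 * int (Suc l) ^ 3"
    and block: "\<And>m. e m \<noteq> 0 \<Longrightarrow> \<exists>l\<in>block m. b l = 0"
  shows "x = \<one>"
proof -
  define c where "c l = b l + e (floor_log (Suc l))" for l
  obtain L0 where L0: "\<And>l. l \<ge> L0 \<Longrightarrow> b l = 0 \<and> e l = 0" "\<And>L. L \<ge> L0 \<Longrightarrow> x = comb L b e"
    using rep unfolding represents_def by blast
  have ec: "\<exists>l\<in>block m. c l \<noteq> 0" if em: "e m \<noteq> 0" for m
  proof -
    obtain l where "l \<in> block m" "b l = 0" using block[OF em] by blast
    then show ?thesis using em by (auto simp: c_def block_def)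
  qed
  have "{l. c l \<noteq> 0} \<subseteq> {..<L0} \<union> (\<Union>m<L0. block m)"
    using L0(1) by (fastforce simp: c_def block_def not_le[symmetric])
  then have fin: "finite {l. c l \<noteq> 0}"
    by (rule finite_subset) (simp add: finite_block)
  have "c l = 0" for l
  proof (rule ccontr)
    assume "c l \<noteq> 0"
    define k where "k = Max {l. c l \<noteq> 0}"
    have k: "c k \<noteq> 0"
      using Max_in[OF fin] \<open>c l \<noteq> 0\<close> by (auto simp: k_def)
    have max: "c l = 0" if "l > k" for l
      using Max_ge[OF fin, of l] that by (auto simp: k_def not_le[symmetric])
    have em: "m \<le> k" if em0: "e m \<noteq> 0" for m
    proof -
      obtain l where "l \<in> block m" "c l \<noteq> 0" using ec[OF em0] by blast
      then show ?thesis using block_bounds(3)[of l m] max[of l] by (meson leI order_trans)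
    qed
    have "k \<ge> k0"
    proof (rule ccontr)
      assume "\<not> k \<ge> k0"
      moreover have "floor_log (Suc k) \<le> k"
        using block_bounds(3)[of k] by (simp add: block_def)
      ultimately show False using low k by (simp add: c_def)
    qed
    then have xk: "x \<in> F k" using x F_mono by blast
    define L where "L = max L0 (Suc k)"
    have y_pow: "y l [^] c l \<in> F k" if "l \<noteq> k" for l
    proof (cases "l < k")
      case True
      then have "y l \<in> F k" using y_mem[of l] F_mono[of "Suc l" k] by auto
      then show ?thesis using subgroup_int_pow_closed[OF F_subgroup] by blast
    next
      case False
      then show ?thesis using that max[of l] subgroup.one_closed[OF F_subgroup] by simp
    qed
    have h_pow: "h m [^] e m \<in> F k" for m
    proof (cases "e m = 0")
      case True
      then show ?thesis using subgroup.one_closed[OF F_subgroup] by simp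
    next
      case False
      then have "h m \<in> F k" using em h_mem[of m] F_mono[of m k] by blast
      then show ?thesis using subgroup_int_pow_closed[OF F_subgroup] by blast
    qed
    let ?P = "finprod G (\<lambda>l. y l [^] c l) ({..<L} - {k})"
    let ?Q = "finprod G (\<lambda>m. h m [^] e m) {..<L}"
    have PQ: "?P \<in> F k" "?Q \<in> F k"
      using y_pow h_pow by (auto intro!: finprod_in_subgroup[OF F_subgroup])
    then have PQc: "?P \<in> carrier G" "?Q \<in> carrier G"
      using subgroup.mem_carrier[OF F_subgroup] by blast+
    have "{..<L} = insert k ({..<L} - {k})" by (auto simp: L_def)
    then have "finprod G (\<lambda>l. y l [^] c l) {..<L} = finprod G (\<lambda>l. y l [^] c l) (insert k ({..<L} - {k}))"
      by simp
    also have "\<dots> = y k [^] c k \<otimes> ?P"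
      using y_carrier by (intro finprod_insert) auto
    finally have "x = y k [^] c k \<otimes> ?P \<otimes> ?Q"
      using L0(2)[of L] by (simp add: L_def comb_def c_def)
    then have "y k [^] c k = x \<otimes> inv (?P \<otimes> ?Q)"
      using PQc y_carrier by (simp add: m_assoc)
    then have "y k [^] c k \<in> F k"
      using xk PQ by (metis F_subgroup subgroup.m_closed subgroup.m_inv_closed)
    then have "y k [^] (nat \<bar>c k\<bar>) \<in> F k"
      by (rule int_pow_mem_abs[OF F_subgroup y_carrier])
    moreover have "nat \<bar>c k\<bar> \<in> {1..2 * Suc k ^ 3}"
    proof -
      have "\<bar>c k\<bar> \<le> 2 * int (Suc k) ^ 3"
        using size[of k] unfolding c_def by linarith
      then have "\<bar>c k\<bar> \<le> int (2 * Suc k ^ 3)" by simp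
      then have "nat \<bar>c k\<bar> \<le> 2 * Suc k ^ 3" by (simp only: nat_le_iff)
      then show ?thesis using k by (simp add: Suc_le_eq)
    qed
    ultimately show False using order by blast
  qed
  then have "e m = 0" for m using ec by blast
  then have "b l = 0" for l using \<open>\<And>l. c l = 0\<close> by (simp add: c_def)
  then have "x = comb L0 (\<lambda>_. 0) (\<lambda>_. 0)"
    using L0(2)[of L0] \<open>\<And>m. e m = 0\<close> by (simp add: comb_def)
  then show ?thesis by (simp add: comb_def)
qed

lemma nbhd_excludes:
  assumes x: "x \<in> carrier G" "x \<noteq> \<one>"
  shows "\<exists>f. x \<notin> nbhd f"
proof (cases "x \<in> (\<Union>k. F k)")
  case False
  then show ?thesis using nbhd_subset_F by blast
next
  case True
  then obtain k0 where k0: "x \<in> F k0" by blast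
  \<comment> \<open>At most \<open>m\<close> factors have an index before the end of block \<open>m\<close>, which has \<open>2\<^sup>m > m\<close> elements.\<close>
  define f where "f i = k0 + 2 * 2 ^ i" for i :: nat
  have "x \<notin> nbhd f"
  proof
    assume "x \<in> nbhd f"
    then obtain K where "x \<in> prods (\<lambda>i. tail (f i)) K" unfolding nbhd_def by blast
    then obtain b e where be: "represents b e x"
      "\<And>l. \<bar>b l\<bar> \<le> int ((Suc l)\<^sup>2) * int (card {i. i < K \<and> f i \<le> l})"
      "\<And>l. \<bar>e l\<bar> \<le> int (card {i. i < K \<and> f i \<le> l})"
      "\<And>n. card {l. l < n \<and> b l \<noteq> 0} \<le> card {i. i < K \<and> f i < n}"
      using prods_represented by blast
    have fi: "f i > k0" "f i > i" for i
    proof -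
      have "i < 2 ^ i" by (rule less_exp)
      then show "f i > k0" "f i > i" unfolding f_def by linarith+
    qed
    have cnt: "card {i. i < K \<and> f i \<le> l} \<le> Suc l" for l
    proof -
      have "{i. i < K \<and> f i \<le> l} \<subseteq> {..l}" using fi(2) by (force intro: less_imp_le less_le_trans)
      then show ?thesis using card_mono[of "{..l}"] by force
    qed
    have "x = \<one>"
    proof (rule trivial_of_represented[OF k0 be(1)])
      fix l assume "l < k0"
      then have none: "{i. i < K \<and> f i \<le> l} = {}" using fi(1) by (auto simp: not_le intro: less_trans)
      show "b l = 0 \<and> e l = 0" using be(2)[of l] be(3)[of l] unfolding none by simp
    next
      fix l
      have "floor_log (Suc l) \<le> l" using block_bounds(3)[of l] by (simp add: block_def)
      then have "\<bar>e (floor_log (Suc l))\<bar> \<le> int (Suc l)"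
        using be(3)[of "floor_log (Suc l)"] cnt[of "floor_log (Suc l)"] by linarith
      moreover have "\<bar>b l\<bar> \<le> int ((Suc l)\<^sup>2) * int (Suc l)"
        using be(2)[of l] cnt[of l] by (meson mult_left_mono of_nat_0_le_iff of_nat_mono order_trans)
      moreover have "int ((Suc l)\<^sup>2) * int (Suc l) = int (Suc l) ^ 3"
        by (simp only: of_nat_mult power2_eq_square power3_eq_cube)
      moreover have "int (Suc l) \<le> int (Suc l) ^ 3"
        using self_le_power[of "int (Suc l)" 3] by simp
      ultimately show "\<bar>b l\<bar> + \<bar>e (floor_log (Suc l))\<bar> \<le> 2 * int (Suc l) ^ 3" by linarith
    next
      fix m
      show "\<exists>l\<in>block m. b l = 0"
      proof (rule ccontr)
        assume "\<not> ?thesis"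
        then have "block m \<subseteq> {l. l < 2 * 2 ^ m \<and> b l \<noteq> 0}"
          using block_bounds(2)[of _ m] by fastforce
        then have "2 ^ m \<le> card {l. l < 2 * 2 ^ m \<and> b l \<noteq> 0}"
          using card_mono[of "{l. l < 2 * 2 ^ m \<and> b l \<noteq> 0}" "block m"] by (simp add: card_block)
        also have "\<dots> \<le> card {i. i < K \<and> f i < 2 * 2 ^ m}" by (rule be(4))
        also have "\<dots> \<le> card {..<m}"
        proof (rule card_mono)
          show "{i. i < K \<and> f i < 2 * 2 ^ m} \<subseteq> {..<m}"
          proof
            fix i assume "i \<in> {i. i < K \<and> f i < 2 * 2 ^ m}"
            then have "k0 + 2 * 2 ^ i < 2 * 2 ^ m" by (simp add: f_def)
            then have "(2::nat) ^ i < 2 ^ m" by linarith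
            then show "i \<in> {..<m}" by simp
          qed
        qed simp
        finally have "2 ^ m \<le> m" by simp
        moreover have "m < 2 ^ m" by (rule less_exp)
        ultimately show False by linarith
      qed
    qed
    then show False using x by simp
  qed
  then show ?thesis by blast
qed

lemma y_neq_one: "y k \<noteq> \<one>"
  using order[of 1 k] subgroup.one_closed[OF F_subgroup[of k]] y_carrier[of k] by auto

lemma null_topology_admissible:
  "group_topology G null_topology" "Hausdorff_space null_topology"
  "complete_group_topology G null_topology" "null_topology \<noteq> discrete_topology (carrier G)"
proof -
  show "null_topology \<noteq> discrete_topology (carrier G)"
  proof (rule null_topology_not_discrete)
    fix n assume "B n \<subseteq> {\<one>}"
    moreover have "y n [^] (1::int) \<in> B n" unfolding B_def by force
    ultimately show False using y_neq_one y_carrier by auto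
  qed
qed (use group_topology_null_topology complete_null_topology nbhd_excludes
      Hausdorff_null_topology in blast)+

text \<open>
  A block has \<open>2\<^sup>m\<close> elements, and each contributes at most \<open>2 / 4\<^sup>m\<close>.
\<close>

lemma norm_block_prod_minus_1:
  assumes hom: "\<phi> \<in> hom G circle_group"
    and close: "\<And>l. l \<in> block m \<Longrightarrow> norm (\<phi> (y l) - 1) \<le> 2 / real (Suc l) ^ 2"
  shows "norm (\<phi> (finprod G y (block m)) - 1) \<le> 2 / 2 ^ m"
proof -
  have "\<phi> (finprod G y (block m)) = (\<Prod>l\<in>block m. \<phi> (y l))"
    using hom finite_block y_carrier by (intro hom_circle_group_finprod) auto
  also have "norm (\<dots> - 1) \<le> (\<Sum>l\<in>block m. norm (\<phi> (y l) - 1))"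
    using finite_block hom_circle_groupD(1)[OF hom y_carrier] by (intro norm_prod_minus_1_le) auto
  also have "\<dots> \<le> (\<Sum>l\<in>block m. 2 / (2 ^ m) ^ 2)"
  proof (rule sum_mono)
    fix l assume l: "l \<in> block m"
    have "real (2 ^ m) \<le> real (Suc l)" using block_bounds(1)[OF l] by (rule of_nat_mono)
    then have "(2 ^ m) ^ 2 \<le> real (Suc l) ^ 2" by (intro power_mono) auto
    then have "2 / real (Suc l) ^ 2 \<le> 2 / (2 ^ m) ^ 2" by (intro divide_left_mono) auto
    then show "norm (\<phi> (y l) - 1) \<le> 2 / (2 ^ m) ^ 2" using close[OF l] by linarith
  qed
  also have "\<dots> = 2 / 2 ^ m" by (simp add: card_block power2_eq_square)
  finally show ?thesis .
qed

lemma character_trivial_on_frequent_value: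
  assumes \<phi>: "\<phi> \<in> characters G null_topology" and x: "\<And>n. \<exists>m\<ge>n. h m = x"
  shows "\<phi> x = 1"
proof -
  have hom: "\<phi> \<in> hom G circle_group" using \<phi> by (simp add: characters_def)
  note homD = hom_circle_groupD[OF hom]
  obtain n1 where n1: "\<And>b. b \<in> tail n1 \<Longrightarrow> norm (\<phi> b - 1) < 1"
    using character_small_on_tail[OF \<phi>, of 1] by auto
  have B_tail: "b \<in> tail n" if "b \<in> B m" "m \<ge> n" for b m n
    using that by (auto simp: tail_def)
  have y: "norm (\<phi> (y l) - 1) \<le> 2 / real (Suc l) ^ 2" if l: "l \<ge> n1" for l
  proof -
    have "norm (\<phi> (y l) - 1) \<le> 2 / real ((Suc l)\<^sup>2)"
    proof (rule norm_minus_1_le_of_powers)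
      fix j assume "j \<le> (Suc l)\<^sup>2"
      then have "\<bar>int j\<bar> \<le> int ((Suc l)\<^sup>2)" by (simp only: abs_of_nat of_nat_le_iff)
      then have "y l [^] int j \<in> B l" unfolding B_def by blast
      then have "norm (\<phi> (y l [^] int j) - 1) < 1" using n1 B_tail l by blast
      then show "norm (\<phi> (y l) ^ j - 1) \<le> 1"
        using hom_circle_group_int_pow[OF hom y_carrier] by simp
    qed (use homD(1)[OF y_carrier] in auto)
    then show ?thesis by simp
  qed
  have "norm (\<phi> x - 1) \<le> \<epsilon>" if "\<epsilon> > 0" for \<epsilon>
  proof -
    obtain n2 where n2: "\<And>b. b \<in> tail n2 \<Longrightarrow> norm (\<phi> b - 1) < \<epsilon> / 2"
      using character_small_on_tail[OF \<phi>, of "\<epsilon> / 2"] \<open>\<epsilon> > 0\<close> by auto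
    obtain n3 where n3: "(1 / 2 :: real) ^ n3 < \<epsilon> / 4"
      using real_arch_pow_inv[of "\<epsilon> / 4" "1 / 2"] \<open>\<epsilon> > 0\<close> by auto
    obtain m where m: "m \<ge> max n1 (max n2 n3)" "h m = x" using x by blast
    have "norm (\<phi> (finprod G y (block m)) - 1) \<le> 2 / 2 ^ m"
      using y m(1) block_bounds(3)[of _ m] by (intro norm_block_prod_minus_1[OF hom]) force
    also have "2 / 2 ^ m \<le> 2 * (1 / 2 :: real) ^ n3"
      using m(1) by (simp add: power_one_over divide_simps)
    finally have Y: "norm (\<phi> (finprod G y (block m)) - 1) < \<epsilon> / 2" using n3 by simp
    have "d m \<in> tail n2" using m(1) B_tail[of "d m" m n2] by (simp add: B_def)
    then have D: "norm (\<phi> (d m) - 1) < \<epsilon> / 2" using n2 by blast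
    define Y where "Y = finprod G y (block m)"
    have Yc: "Y \<in> carrier G" using y_carrier by (simp add: Y_def Pi_iff)
    have "h m = d m \<otimes> inv Y"
      using Yc h_carrier by (simp add: d_def Y_def[symmetric] m_assoc)
    then have "\<phi> x = \<phi> (d m) * inverse (\<phi> Y)"
      using m(2) homD(2)[OF d_carrier, of "inv Y"] Yc hom_circle_group_inv[OF hom Yc] by simp
    then have "norm (\<phi> x - 1) \<le> norm (\<phi> (d m) - 1) + norm (inverse (\<phi> Y) - 1)"
      using norm_mult_minus_1_le[OF homD(1)[OF d_carrier]] by simp
    also have "norm (inverse (\<phi> Y) - 1) = norm (\<phi> Y - 1)"
      using homD(1)[OF Yc] by (rule norm_inverse_minus_1)
    finally show ?thesis using D Y by (simp add: Y_def)
  qed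
  then show ?thesis using field_le_epsilon[of "norm (\<phi> x - 1)" 0] by simp
qed

lemma characterI:
  assumes hom: "\<phi> \<in> hom G circle_group" and h: "\<And>m. \<phi> (h m) = 1"
    and y: "\<And>l. l \<ge> n0 \<Longrightarrow> norm (\<phi> (y l) - 1) \<le> 2 / real (Suc l) ^ 3"
  shows "\<phi> \<in> characters G null_topology"
proof (rule characterI_small_on_tail[OF hom])
  note homD = hom_circle_groupD[OF hom]
  fix \<epsilon> :: real assume "\<epsilon> > 0"
  obtain n1 where n1: "2 / \<epsilon> < real n1" using reals_Archimedean2 by blast
  define n where "n = max n0 n1"
  have small: "2 / real (Suc m) < \<epsilon>" if "m \<ge> n" for m
  proof -
    have "2 / \<epsilon> < real (Suc m)" using n1 that by (simp add: n_def)
    then show ?thesis using \<open>\<epsilon> > 0\<close> by (simp add: field_simps)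
  qed
  have "norm (\<phi> b - 1) < \<epsilon>" if b: "b \<in> B m" and m: "m \<ge> n" for b m
  proof (cases "b \<in> {d m, inv (d m)}")
    case True
    have "norm (\<phi> (y l) - 1) \<le> 2 / real (Suc l) ^ 2" if "l \<in> block m" for l
    proof -
      have "l \<ge> n0" using block_bounds(3)[OF that] m by (simp add: n_def)
      then have "norm (\<phi> (y l) - 1) \<le> 2 / real (Suc l) ^ 3" by (rule y)
      also have "\<dots> \<le> 2 / real (Suc l) ^ 2"
        by (intro divide_left_mono power_increasing) auto
      finally show ?thesis .
    qed
    then have "norm (\<phi> (finprod G y (block m)) - 1) \<le> 2 / 2 ^ m"
      by (rule norm_block_prod_minus_1[OF hom])
    also have "2 / 2 ^ m \<le> 2 / real (Suc m)"
    proof -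
      have "Suc m \<le> 2 ^ m" by (rule Suc_leI) (rule less_exp)
      then have "real (Suc m) \<le> 2 ^ m" by (metis of_nat_mono of_nat_numeral of_nat_power)
      then show ?thesis by (intro divide_left_mono) auto
    qed
    also have "\<dots> < \<epsilon>" using small[OF m] .
    finally have "norm (\<phi> (finprod G y (block m)) - 1) < \<epsilon>" .
    then have "norm (\<phi> (d m) - 1) < \<epsilon>"
      using homD(2)[OF h_carrier, of "finprod G y (block m)" m] h y_carrier by (simp add: d_def Pi_iff)
    moreover have "norm (\<phi> (inv (d m)) - 1) = norm (\<phi> (d m) - 1)"
      using hom_circle_group_inv[OF hom d_carrier] norm_inverse_minus_1[OF homD(1)[OF d_carrier]] by simp
    ultimately show ?thesis using True by auto
  next
    case False
    then obtain j :: int where j: "b = y m [^] j" "\<bar>j\<bar> \<le> int ((Suc m)\<^sup>2)"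
      using b by (auto simp: B_def)
    have "norm (\<phi> b - 1) \<le> real_of_int \<bar>j\<bar> * norm (\<phi> (y m) - 1)"
      using hom_circle_group_int_pow[OF hom y_carrier]
        norm_power_int_minus_1_le[OF homD(1)[OF y_carrier]] j(1) by simp
    also have "\<dots> \<le> real (Suc m) ^ 2 * (2 / real (Suc m) ^ 3)"
    proof (rule mult_mono)
      have "real_of_int \<bar>j\<bar> \<le> real_of_int (int ((Suc m)\<^sup>2))" using j(2) by linarith
      then show "real_of_int \<bar>j\<bar> \<le> real (Suc m) ^ 2" by simp
      show "norm (\<phi> (y m) - 1) \<le> 2 / real (Suc m) ^ 3" using y m by (simp add: n_def)
    qed auto
    also have "\<dots> = 2 / real (Suc m)"
      by (simp add: power2_eq_square power3_eq_cube del: of_nat_Suc)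
    also have "\<dots> < \<epsilon>" using small[OF m] .
    finally show ?thesis .
  qed
  then have "norm (\<phi> b - 1) < \<epsilon>" if "b \<in> tail n" for b
    using that hom_circle_group_one[OF hom] \<open>\<epsilon> > 0\<close> by (auto simp: tail_def)
  then show "\<exists>n. \<forall>b\<in>tail n. norm (\<phi> b - 1) < \<epsilon>" by blast
qed

end

section \<open>Construction of the sequence and separation by characters\<close>

lemma (in group) subgroup_Union_chain:
  assumes "\<And>k::nat. subgroup (M k) G" "\<And>k. M k \<subseteq> M (Suc k)"
  shows "subgroup (\<Union>k. M k) G"
proof (rule subgroup.intro)
  have mono: "M j \<subseteq> M k" if "j \<le> k" for j k
    by (rule lift_Suc_mono_le[of M]) (use assms(2) that in auto)
  show "(\<Union>k. M k) \<subseteq> carrier G" using assms(1) subgroup.subset by blast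
  show "\<one> \<in> (\<Union>k. M k)" using assms(1) subgroup.one_closed by blast
  show "inv x \<in> (\<Union>k. M k)" if x: "x \<in> (\<Union>k. M k)" for x
    using x subgroup.m_inv_closed[OF assms(1)] by (elim UN_E) (rule UN_I, auto)
  fix x z assume "x \<in> (\<Union>k. M k)" "z \<in> (\<Union>k. M k)"
  then obtain i j where "x \<in> M i" "z \<in> M j" by blast
  then have "x \<in> M (max i j)" "z \<in> M (max i j)"
    using mono[of i "max i j"] mono[of j "max i j"] by auto
  then have "x \<otimes> z \<in> M (max i j)" by (rule subgroup.m_closed[OF assms(1)])
  then show "x \<otimes> z \<in> (\<Union>k. M k)" by blast
qed

text \<open>
  If \<open>a\<close> lies in some \<open>M k0\<close>, a character separating \<open>a\<close> from \<open>H\<close> is restricted to \<open>M k0\<close> and extended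
  anew, step by step, so that its values at the further \<open>y k\<close> are close to 1. Otherwise a
  character that is trivial on all \<open>M k\<close> will do.
\<close>

lemma (in comm_group) exists_close_separating_character:
  fixes N :: "nat \<Rightarrow> nat"
  assumes M: "\<And>k. subgroup (M k) G" "\<And>k. M k \<subseteq> M (Suc k)"
    and H: "subgroup H G" "\<And>k. H \<subseteq> M k"
    and y: "\<And>k. y k \<in> carrier G" "\<And>k. y k \<in> M (Suc k)"
    and ord: "\<And>k. y k \<in> H \<or> (\<forall>n\<in>{1..N k}. y k [^] n \<notin> M k)"
    and a: "a \<in> carrier G" "a \<notin> H"
  obtains \<phi> n0 where "\<phi> \<in> hom G circle_group" "\<And>x. x \<in> H \<Longrightarrow> \<phi> x = 1" "\<phi> a \<noteq> 1"
    "\<And>k. k \<ge> n0 \<Longrightarrow> norm (\<phi> (y k) - 1) \<le> 4 / real (N k + 1)"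
proof (cases "a \<in> (\<Union>k. M k)")
  case False
  have U: "subgroup (\<Union>k. M k) G" using M by (rule subgroup_Union_chain)
  obtain \<phi> where \<phi>: "\<phi> \<in> hom G circle_group" "\<And>x. x \<in> (\<Union>k. M k) \<Longrightarrow> \<phi> x = 1" "\<phi> a \<noteq> 1"
    by (rule exists_separating_character[OF U a(1) False]) (rule that)
  have "\<phi> x = 1" if "x \<in> H" for x using \<phi>(2) H(2) that by blast
  moreover have "\<phi> (y k) = 1" for k using \<phi>(2) y(2) by blast
  ultimately show ?thesis using \<phi> by (intro that[of \<phi> 0]) auto
next
  case True
  then obtain k0 where k0: "a \<in> M k0" by blast
  obtain \<psi> where \<psi>: "\<psi> \<in> hom G circle_group" "\<And>x. x \<in> H \<Longrightarrow> \<psi> x = 1" "\<psi> a \<noteq> 1"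
    using exists_separating_character[OF H(1) a] by metis
  define R0 where "R0 = {(x, \<psi> x) | x. x \<in> M k0}"
  have Mc: "x \<in> carrier G" if "x \<in> M k" for x k using subgroup.mem_carrier[OF M(1) that] .
  have R0: "partial_character G R0"
    unfolding partial_character_def R0_def
    using Mc hom_circle_groupD[OF \<psi>(1)] hom_circle_group_one[OF \<psi>(1)] hom_circle_group_inv[OF \<psi>(1)]
      subgroup.one_closed[OF M(1)] subgroup.m_closed[OF M(1)] subgroup.m_inv_closed[OF M(1)]
    by auto
  define P where "P n R \<longleftrightarrow> partial_character G R \<and> Domain R \<subseteq> M (k0 + n) \<and> R0 \<subseteq> R" for n R
  define Q where "Q n R R' \<longleftrightarrow> R \<subseteq> R' \<and>
    (\<exists>\<theta>. (y (k0 + n), \<theta>) \<in> R' \<and> norm (\<theta> - 1) \<le> 4 / real (N (k0 + n) + 1))"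
    for n and R R' :: "('a \<times> complex) set"
  have "\<exists>R. P 0 R" using R0 by (intro exI[of _ R0]) (auto simp: P_def R0_def)
  moreover have "\<exists>R'. P (Suc n) R' \<and> Q n R R'" if PR: "P n R" for n R
  proof (cases "y (k0 + n) \<in> H")
    case True
    then have "(y (k0 + n), 1) \<in> R0"
      using \<psi>(2) H(2) unfolding R0_def by force
    then have "(y (k0 + n), 1) \<in> R" using PR by (auto simp: P_def)
    then show ?thesis
      using PR M(2)[of "k0 + n"] unfolding P_def Q_def by (intro exI[of _ R]) (auto intro!: exI[of _ 1])
  next
    case False
    have R: "partial_character G R" "Domain R \<subseteq> M (k0 + n)" "R0 \<subseteq> R"
      using PR by (auto simp: P_def)
    have "y (k0 + n) [^] j \<notin> Domain R" if "j \<in> {1..N (k0 + n)}" for j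
      using ord[of "k0 + n"] False that R(2) by blast
    then obtain R' \<theta> where R': "partial_character G R'" "R \<subseteq> R'" "(y (k0 + n), \<theta>) \<in> R'"
      "norm (\<theta> - 1) \<le> 4 / real (N (k0 + n) + 1)"
      "\<And>x. x \<in> Domain R' \<Longrightarrow> \<exists>a\<in>Domain R. \<exists>i::int. x = a \<otimes> y (k0 + n) [^] i"
      using partial_character_extend_close[OF R(1) y(1)] by metis
    have "x \<in> M (Suc (k0 + n))" if x: "x \<in> Domain R'" for x
    proof -
      obtain b i where "b \<in> Domain R" "x = b \<otimes> y (k0 + n) [^] (i::int)" using R'(5)[OF x] by blast
      moreover have "b \<in> M (Suc (k0 + n))" using \<open>b \<in> Domain R\<close> R(2) M(2) by blast
      ultimately show ?thesis
        using subgroup.m_closed[OF M(1)] subgroup_int_pow_closed[OF M(1) y(2)] by simp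
    qed
    then have "P (Suc n) R'" using R' R(3) by (auto simp: P_def)
    moreover have "Q n R R'" using R' by (auto simp: Q_def)
    ultimately show ?thesis by blast
  qed
  ultimately obtain R where R: "\<And>n. P n (R n)" "\<And>n. Q n (R n) (R (Suc n))"
    using dependent_nat_choice[of P Q] by metis
  have R_mono: "R m \<subseteq> R n" if "m \<le> n" for m n
    by (rule lift_Suc_mono_le[of R]) (use R(2) that in \<open>auto simp: Q_def\<close>)
  have "partial_character G (\<Union>(range R))"
  proof (rule partial_character_Union_chain)
    fix S S' assume "S \<in> range R" "S' \<in> range R"
    then obtain m n where "S = R m" "S' = R n" by blast
    then show "S \<subseteq> S' \<or> S' \<subseteq> S" using R_mono[of m n] R_mono[of n m] by (meson nle_le)
  qed (use R(1) in \<open>auto simp: P_def\<close>)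
  then obtain \<phi> where \<phi>: "\<phi> \<in> hom G circle_group" "\<And>x z. (x, z) \<in> \<Union>(range R) \<Longrightarrow> \<phi> x = z"
    using partial_character_extends_to_character by metis
  have "R0 \<subseteq> \<Union>(range R)" using R(1)[of 0] by (auto simp: P_def)
  then have \<phi>\<psi>: "\<phi> x = \<psi> x" if "x \<in> M k0" for x
    using \<phi>(2)[of x "\<psi> x"] that by (auto simp: R0_def)
  have "norm (\<phi> (y k) - 1) \<le> 4 / real (N k + 1)" if k: "k \<ge> k0" for k
  proof -
    obtain \<theta> where "(y k, \<theta>) \<in> R (Suc (k - k0))" "norm (\<theta> - 1) \<le> 4 / real (N k + 1)"
      using R(2)[of "k - k0"] k unfolding Q_def by auto
    then show ?thesis using \<phi>(2)[of "y k" \<theta>] by blast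
  qed
  moreover have "\<phi> x = 1" if "x \<in> H" for x using \<phi>\<psi>[of x] \<psi>(2) H(2) that by force
  moreover have "\<phi> a \<noteq> 1" using \<phi>\<psi>[OF k0] \<psi>(3) by simp
  ultimately show ?thesis using \<phi>(1) that by blast
qed

text \<open>
  The \<open>y k\<close> are chosen one after another, \<open>S k\<close> being the finite set of elements modulo which
  \<open>y k\<close> must have large order. The subgroup \<open>M k\<close> is generated by \<open>H\<close> and \<open>S k\<close>.
\<close>

lemma (in comm_group) exists_spread_sequence:
  assumes g: "g \<in> carrier G" "g \<noteq> \<one>" "infinite_height G g"
    and H: "subgroup H G" and h: "\<And>k. h k \<in> H"
  obtains y F M where "spread_sequence G h y F"
    "\<And>k. subgroup (M k) G" "\<And>k. M k \<subseteq> M (Suc k)" "\<And>k. H \<subseteq> M k" "\<And>k. y k \<in> M (Suc k)"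
    "\<And>k. y k \<in> H \<or> (\<forall>n\<in>{1..2 * Suc k ^ 3}. y k [^] (n::nat) \<notin> M k)"
proof -
  define ok where "ok k S v \<longleftrightarrow> v \<in> carrier G \<and>
      (\<forall>n\<in>{1..2 * Suc k ^ 3}. v [^] (n::nat) \<notin> generate G S) \<and>
      (v \<in> H \<or> (\<forall>n\<in>{1..2 * Suc k ^ 3}. v [^] n \<notin> generate G (H \<union> S)))" for k S v
  define Y where "Y k S = (SOME v. ok k S v)" for k S
  define S where "S = rec_nat {h 0} (\<lambda>k S. insert (Y k S) (insert (h (Suc k)) S))"
  define y where "y k = Y k (S k)" for k
  have S_0: "S 0 = {h 0}" and S_Suc: "S (Suc k) = insert (y k) (insert (h (Suc k)) (S k))" for k
    by (simp_all add: S_def y_def)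
  have hc: "h k \<in> carrier G" for k using h H subgroup.mem_carrier by metis
  have Y: "ok k T (Y k T)" if T: "finite T" "T \<subseteq> carrier G" for k T
  proof -
    have "\<exists>v. ok k T v"
      using exists_large_order_mod[OF g H T, of "2 * Suc k ^ 3"] unfolding ok_def by blast
    then show ?thesis unfolding Y_def by (rule someI_ex)
  qed
  have S: "finite (S k) \<and> S k \<subseteq> carrier G" for k
  proof (induction k)
    case (Suc k)
    then have "y k \<in> carrier G" using Y[of "S k" k] by (simp add: ok_def y_def)
    then show ?case using Suc hc by (simp add: S_Suc)
  qed (simp add: S_0 hc)
  have y: "ok k (S k) (y k)" for k using Y S by (simp add: y_def)
  have HS: "H \<union> S k \<subseteq> carrier G" for k using S H subgroup.subset by blast
  have hS: "h k \<in> S k" for k by (cases k) (simp_all add: S_0 S_Suc)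
  have yk: "y k \<in> carrier G" "\<And>n. n \<in> {1..2 * Suc k ^ 3} \<Longrightarrow> y k [^] (n::nat) \<notin> generate G (S k)"
    "y k \<in> H \<or> (\<forall>n\<in>{1..2 * Suc k ^ 3}. y k [^] (n::nat) \<notin> generate G (H \<union> S k))" for k
    using y[of k] unfolding ok_def by blast+
  show ?thesis
  proof (rule that[of y "\<lambda>k. generate G (S k)" "\<lambda>k. generate G (H \<union> S k)"])
    show "spread_sequence G h y (\<lambda>k. generate G (S k))"
    proof (rule spread_sequence.intro[OF comm_group_axioms], rule spread_sequence_axioms.intro)
      fix k
      show "h k \<in> carrier G" by (rule hc)
      show "y k \<in> carrier G" by (rule yk)
      show "subgroup (generate G (S k)) G" using S by (simp add: generate_is_subgroup)
      show "generate G (S k) \<subseteq> generate G (S (Suc k))"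
        by (rule mono_generate) (auto simp: S_Suc)
      show "h k \<in> generate G (S k)" using hS by (rule generate.incl)
      show "y k \<in> generate G (S (Suc k))" by (rule generate.incl) (simp add: S_Suc)
      show "y k [^] n \<notin> generate G (S k)" if "n \<in> {1..2 * Suc k ^ 3}" for n :: nat
        using that by (rule yk)
    qed
    fix k
    show "subgroup (generate G (H \<union> S k)) G" using HS by (rule generate_is_subgroup)
    show "generate G (H \<union> S k) \<subseteq> generate G (H \<union> S (Suc k))"
      by (rule mono_generate) (auto simp: S_Suc)
    show "H \<subseteq> generate G (H \<union> S k)" by (auto intro: generate.incl)
    show "y k \<in> generate G (H \<union> S (Suc k))" by (rule generate.incl) (simp add: S_Suc)
    show "y k \<in> H \<or> (\<forall>n\<in>{1..2 * Suc k ^ 3}. y k [^] (n::nat) \<notin> generate G (H \<union> S k))"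
      by (rule yk)
  qed
qed

section \<open>Countable subgroups as von Neumann radicals\<close>

theorem corollary5:
  fixes G :: "('a, 'b) monoid_scheme" and H :: "'a set"
  assumes "comm_group G" and "infinite (carrier G)"
    and "subgroup H G" and "countable H"
    and "\<exists>g\<in>carrier G. g \<noteq> \<one>\<^bsub>G\<^esub> \<and> infinite_height G g"
  shows "H \<in> NRC G"
proof -
  interpret comm_group G by fact
  obtain g where g: "g \<in> carrier G" "g \<noteq> \<one>\<^bsub>G\<^esub>" "infinite_height G g"
    using assms(5) by blast
  define h where "h k = from_nat_into H (fst (prod_decode k))" for k
  have "H \<noteq> {}" using subgroup.one_closed[OF assms(3)] by blast
  then have hH: "h k \<in> H" for k by (simp add: h_def from_nat_into)
  have frequent: "\<exists>m\<ge>n. h m = x" if x: "x \<in> H" for x n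
  proof -
    obtain i where "from_nat_into H i = x"
      using from_nat_into_surj[OF assms(4) x] by blast
    then show ?thesis
      by (intro exI[of _ "prod_encode (i, n)"]) (simp add: h_def le_prod_encode_2)
  qed
  obtain y F M where spread: "spread_sequence G h y F"
    and M: "\<And>k. subgroup (M k) G" "\<And>k. M k \<subseteq> M (Suc k)" "\<And>k. H \<subseteq> M k" "\<And>k. y k \<in> M (Suc k)"
      "\<And>k. y k \<in> H \<or> (\<forall>n\<in>{1..2 * Suc k ^ 3}. y k [^]\<^bsub>G\<^esub> (n::nat) \<notin> M k)"
    using exists_spread_sequence[where h = h, OF g assms(3) hH] by blast
  interpret S: spread_sequence G h y F by (rule spread)
  have small: "z \<le> 2 / real (Suc k) ^ 3" if "z \<le> 4 / real (2 * Suc k ^ 3 + 1)" for z k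
  proof -
    have "4 / real (2 * Suc k ^ 3 + 1) \<le> 4 / (2 * real (Suc k) ^ 3)"
      by (intro frac_le) auto
    then show ?thesis using that by simp
  qed
  have "von_Neumann_radical G S.null_topology = H"
  proof (intro equalityI subsetI)
    fix x assume "x \<in> H"
    then show "x \<in> von_Neumann_radical G S.null_topology"
      using S.character_trivial_on_frequent_value frequent subgroup.mem_carrier[OF assms(3)]
      by (auto simp: von_Neumann_radical_def kernel_def circle_group_def)
  next
    fix a assume a: "a \<in> von_Neumann_radical G S.null_topology"
    have trivial: "(\<lambda>_. 1) \<in> characters G S.null_topology"
      by (rule S.characterI[of _ 0]) (auto simp: hom_def circle_group_def)
    have ker: "a \<in> carrier G \<and> \<phi> a = 1" if "\<phi> \<in> characters G S.null_topology" for \<phi>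
      using a that by (auto simp: von_Neumann_radical_def kernel_def circle_group_def)
    show "a \<in> H"
    proof (rule ccontr)
      assume "a \<notin> H"
      then obtain \<phi> n0 where \<phi>: "\<phi> \<in> hom G circle_group" "\<And>x. x \<in> H \<Longrightarrow> \<phi> x = 1" "\<phi> a \<noteq> 1"
        "\<And>k. k \<ge> n0 \<Longrightarrow> norm (\<phi> (y k) - 1) \<le> 4 / real (2 * Suc k ^ 3 + 1)"
        using exists_close_separating_character[where N = "\<lambda>k. 2 * Suc k ^ 3",
            OF M(1,2) assms(3) M(3) S.y_carrier M(4,5), of a] ker[OF trivial]
        by metis
      have "\<phi> \<in> characters G S.null_topology"
        by (rule S.characterI[OF \<phi>(1) \<phi>(2)[OF hH] small[OF \<phi>(4)]])
      then show False using ker \<phi>(3) by blast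
    qed
  qed
  then show ?thesis
    unfolding NRC_def using assms(3) S.null_topology_admissible by blast
qed

end
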